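(* Let $E$ be an open subset of $\mathbb R^d$ with the following properties: (1) $\mathbb R^d\setminus E$ is a union of bounded closed sets in $\mathbb R^d$; (2) the diameters of these sets are uniformly bounded; (3) the distance between any two distinct sets of this family is bounded from below by a positive constant (the same for all pairs); (4) the boundary of $E$ is uniformly Lipschitz continuous. Let $\Omega\subset\mathbb R^d$ be an open set with Lipschitz boundary. Then for each $r_0>0$ there exist $k>0$, $r>0$ and $C>0$ such that for every $\varepsilon>0$ and every $u\in L^2(\Omega\cap\varepsilon E)$ there exists $v\in L^2(\Omega)$ such that $$v=u\quad\text{on }\Omega\cap\varepsilon E,$$ $$\int_{(\Omega(k\varepsilon)\times\Omega(k\varepsilon))\cap\{|x-y|\le\varepsilon r\}}\Bigl(\frac{v(y)-v(x)}{\varepsilon}\Bigr)^2dy\,dx\le C\int_{((\Omega\cap\varepsilon E)\times(\Omega\cap\varepsilon E))\cap\{|x-y|\le\varepsilon r_0\}}\Bigl(\frac{u(y)-u(x)}{\varepsilon}\Bigr)^2dy\,dx$$ and $$\int_{\Omega(k\varepsilon)}|v|^2\,dx\le C\int_{\Omega\cap\varepsilon E}|u|^2\,dx .$$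
   Context: For $t>0$, $\Omega(t)=\{x\in\Omega:\operatorname{dist}(x,\partial\Omega)>t\}$. For $\varepsilon>0$, $\varepsilon E=\{\varepsilon x:x\in E\}$. An open subset $\mathcal F$ of $\mathbb R^d$ has a uniformly Lipschitz continuous boundary if there exist constants $L>0$ and $\rho_1,\rho_2>0$ such that for any point $x\in\partial\mathcal F$ there exists a set $\mathbb S$ which, up to translation by $x$ and rotation, is of the form $(-\rho_1,\rho_1)^{d-1}\times(-\rho_2,\rho_2)$ and such that, in these coordinates, $\mathbb S\cap\mathcal F$ is the sub-graph (within $\mathbb S$) of an $L$-Lipschitz function defined on $(-\rho_1,\rho_1)^{d-1}$; this function may be assumed to take values in $(-\rho_2/2,\rho_2/2)$.
   Formalization: The set E is additionally assumed connected; without this the claim fails, e.g. for E the complement of the closed annulus 1≤|x|≤2, Ω a ball of radius 10 about 0, r_0=1/2, and u=1 on εB_1, u=0 elsewhere. *)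

theory Defs
  imports "HOL-Analysis.Analysis"
begin

text \<open>
  The cylinder of radii \<open>\<rho>1\<close>, \<open>\<rho>2\<close> about \<open>x\<close> is the image under \<open>y \<mapsto> x + R y\<close> of the set of all
  \<open>y\<close> with \<open>\<bar>y \<bullet> b\<bar> < \<rho>1\<close> for the basis vectors \<open>b \<noteq> e\<close> and \<open>\<bar>y \<bullet> e\<bar> < \<rho>2\<close>; the
  \<open>(d - 1)\<close>-dimensional base is realised inside the hyperplane \<open>y \<bullet> e = 0\<close>.
  \<open>R\<close> ranges over all orthogonal maps. In dimension at least 2 this is the same as using
  rotations, since a reflection in a horizontal coordinate preserves cylinders and Lipschitz
  sub-graphs; in dimension 1 it is needed, because there the only rotation is the identity.
\<close>

definition cylinder_base :: "'a::euclidean_space \<Rightarrow> real \<Rightarrow> 'a set" where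
  "cylinder_base e \<rho>1 = {z. z \<bullet> e = 0 \<and> (\<forall>b\<in>Basis - {e}. \<bar>z \<bullet> b\<bar> < \<rho>1)}"

definition lipschitz_subgraph_at ::
    "'a::euclidean_space set \<Rightarrow> real \<Rightarrow> real \<Rightarrow> real \<Rightarrow> 'a \<Rightarrow> bool" where
  "lipschitz_subgraph_at F L \<rho>1 \<rho>2 x \<longleftrightarrow>
     (\<exists>(R :: 'a \<Rightarrow> 'a) e g. orthogonal_transformation R \<and> e \<in> Basis \<and>
        L-lipschitz_on (cylinder_base e \<rho>1) g \<and>
        g ` cylinder_base e \<rho>1 \<subseteq> {- \<rho>2 / 2 <..< \<rho>2 / 2} \<and>
        (\<forall>z\<in>cylinder_base e \<rho>1. \<forall>t\<in>{- \<rho>2 <..< \<rho>2}.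
           x + R (z + t *\<^sub>R e) \<in> F \<longleftrightarrow> t < g z))"

definition uniformly_lipschitz_boundary :: "'a::euclidean_space set \<Rightarrow> bool" where
  "uniformly_lipschitz_boundary F \<longleftrightarrow>
     (\<exists>L>0. \<exists>\<rho>1>0. \<exists>\<rho>2>0. \<forall>x\<in>frontier F. lipschitz_subgraph_at F L \<rho>1 \<rho>2 x)"

definition lipschitz_boundary :: "'a::euclidean_space set \<Rightarrow> bool" where
  "lipschitz_boundary F \<longleftrightarrow>
     (\<forall>x\<in>frontier F. \<exists>L>0. \<exists>\<rho>1>0. \<exists>\<rho>2>0. lipschitz_subgraph_at F L \<rho>1 \<rho>2 x)"

text \<open>
  The distance to an empty boundary is infinite, so \<open>inner_part UNIV t = UNIV\<close>; the case is
  listed separately because \<open>infdist x {} = 0\<close>.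
\<close>

definition inner_part :: "'a::metric_space set \<Rightarrow> real \<Rightarrow> 'a set" where
  "inner_part \<Omega> t = {x \<in> \<Omega>. frontier \<Omega> = {} \<or> infdist x (frontier \<Omega>) > t}"

text \<open>Elements of \<open>L\<^sup>2(S)\<close> are represented by functions whose values outside \<open>S\<close> are irrelevant.\<close>

definition square_integrable_on :: "('a::euclidean_space \<Rightarrow> real) \<Rightarrow> 'a set \<Rightarrow> bool"
    (infixr \<open>square'_integrable'_on\<close> 46) where
  "u square_integrable_on S \<longleftrightarrow>
     u \<in> borel_measurable (lebesgue_on S) \<and> integrable (lebesgue_on S) (\<lambda>x. (u x)\<^sup>2)"

definition nonlocal_energy :: "'a::euclidean_space set \<Rightarrow> real \<Rightarrow> real \<Rightarrow> ('a \<Rightarrow> real) \<Rightarrow> ennreal" where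
  "nonlocal_energy A \<epsilon> r w =
     (\<integral>\<^sup>+(x, y)\<in>(A \<times> A) \<inter> {(x, y). norm (x - y) \<le> \<epsilon> * r}.
        ennreal (((w y - w x) / \<epsilon>)\<^sup>2) \<partial>lebesgue)"

end

theory Submission
  imports Defs
begin

text \<open>
  The extension of \<open>u\<close> is constant on each cell of a lattice inside the holes, equal to the mean of
  \<open>u\<close> over a nearby ball contained in the perforated domain. To compare two of its values one
  passes along a chain of balls of a fixed radius in the domain with consecutive centres closer than
  the interaction range. The uniformly Lipschitz boundary puts such a ball near every point. The
  number of balls needed is uniformly bounded, although \<open>E\<close> need not be periodic: by unicoherence of
  Euclidean space the connected set \<open>E\<close> is connected at a bounded scale, and a shortest chain in a
  bounded region is separated, hence short by total boundedness. The squared difference of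
  two values is thus bounded pointwise by local energies near one of the points and at the other,
  and Fubini's theorem concludes. All constants are quotients of volumes, so they do not depend on
  \<open>\<epsilon>\<close>.
\<close>

section \<open>Geometry of the perforated domain\<close>

text \<open>The range \<open>r\<^sub>0\<close> may be far smaller than a hole or than the gap
  between two holes, so values on two sides of a hole cannot be compared by one use of the energy; a
  chain of at most N links pays for the comparison with a factor N^2. Connectedness of
  \<open>E\<close> alone gives no control over such chains: close points might be joined only by
  paths that wander arbitrarily far. Two bounds are needed, one on the number of links, which
  controls the constant, and one on the excursion, which decides how deep inside \<Omega> a point
  has to lie and so fixes k. The excursion is bounded because a path only has to go around the holes
  that meet a fixed ball, and these reach at most \<open>D\<close> beyond it. Means replace values
  because \<open>u\<close> is known only up to null sets. The ball assigned to a point of a hole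
  must depend measurably on that point, which is what the lattice is for. Balls and chains are built
  once for \<open>E\<close> and then dilated, so counts stay fixed and lengths are multiplied by
  \<epsilon>.\<close>

lemma lipschitz_interior_balls:
  fixes E :: "'a::euclidean_space set"
  assumes lip: "uniformly_lipschitz_boundary E" and s: "s > 0"
  shows "\<exists>\<rho>>0. \<rho> \<le> s \<and> (\<forall>x\<in>E. \<exists>p. ball p \<rho> \<subseteq> E \<and> dist x p \<le> s)"
proof -
  obtain L \<rho>1 \<rho>2 where pos: "L > 0" "\<rho>1 > 0" "\<rho>2 > 0"
    and graph: "\<And>x. x \<in> frontier E \<Longrightarrow> lipschitz_subgraph_at E L \<rho>1 \<rho>2 x"
    using lip unfolding uniformly_lipschitz_boundary_def by blast
  \<comment> \<open>The shifted and perturbed coordinates below have norm less than 3\<eta> and so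
    stay inside the cylinder. In \<rho> = \<tau>/(1 + L) the 1 pays for the vertical extent of the
    ball and the L for the possible drop of the graph across it; together they use up the shift
    \<tau>.\<close>
  define \<eta> where "\<eta> = min \<rho>1 \<rho>2 / 4"
  define \<tau> where "\<tau> = min s \<eta>"
  define \<rho> where "\<rho> = \<tau> / (1 + L)"
  have \<eta>: "\<eta> > 0" "4 * \<eta> \<le> \<rho>1" "4 * \<eta> \<le> \<rho>2" using pos by (auto simp: \<eta>_def)
  have \<tau>: "\<tau> > 0" "\<tau> \<le> s" "\<tau> \<le> \<eta>" using \<eta> s by (auto simp: \<tau>_def)
  have \<rho>: "\<rho> > 0" "\<rho> \<le> \<tau>" "\<rho> + L * \<rho> = \<tau>"
  proof -
    show "\<rho> > 0" using \<tau> pos by (simp add: \<rho>_def)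
    have "\<rho> * (1 + L) = \<tau>" using pos by (simp add: \<rho>_def)
    then show *: "\<rho> + L * \<rho> = \<tau>" by (simp add: algebra_simps)
    show "\<rho> \<le> \<tau>" using * \<open>\<rho> > 0\<close> pos mult_pos_pos[of L \<rho>] by linarith
  qed
  have "\<exists>p. ball p \<rho> \<subseteq> E \<and> dist x p \<le> s" if x: "x \<in> E" for x
  proof (cases "ball x \<eta> \<subseteq> E")
    case True
    moreover have "ball x \<rho> \<subseteq> ball x \<eta>" using \<rho> \<tau> by (intro subset_ball) auto
    ultimately show ?thesis using s by (intro exI[of _ x]) auto
  next
    case False
    have "ball x \<eta> \<inter> frontier E \<noteq> {}"
      using False x centre_in_ball[of x \<eta>] \<eta> by (intro connected_Int_frontier) blast+
    then obtain x0 where x0: "x0 \<in> frontier E" "dist x x0 < \<eta>" by auto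
    obtain R :: "'a \<Rightarrow> 'a" and e and g :: "'a \<Rightarrow> real"
      where R: "orthogonal_transformation R" and e: "e \<in> Basis"
      and g: "L-lipschitz_on (cylinder_base e \<rho>1) g"
      and sub: "\<forall>z\<in>cylinder_base e \<rho>1. \<forall>t\<in>{- \<rho>2 <..< \<rho>2}. x0 + R (z + t *\<^sub>R e) \<in> E \<longleftrightarrow> t < g z"
      using graph[OF x0(1)] unfolding lipschitz_subgraph_at_def by metis
    have linR: "linear R" using R by (rule orthogonal_transformation_linear)
    have surjR: "\<exists>w. R w = y" for y
      using orthogonal_transformation_surj[OF R] by (metis surjD)
    have normR: "norm (R w) = norm w" for w
      using R by (rule orthogonal_transformation_norm)
    \<comment> \<open>Orthogonal projection onto the base hyperplane; with it \<open>char\<close>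
      restates the sub-graph condition for any short vector \<open>w\<close>.\<close>
    define proj where "proj w = w - (w \<bullet> e) *\<^sub>R e" for w
    have proj_base: "proj w \<in> cylinder_base e \<rho>1" if "norm w < \<rho>1" for w
    proof -
      have "\<bar>proj w \<bullet> b\<bar> < \<rho>1" if "b \<in> Basis - {e}" for b
      proof -
        have "proj w \<bullet> b = w \<bullet> b"
          using that e by (auto simp: proj_def inner_diff_left inner_Basis)
        then show ?thesis using Basis_le_norm[of b w] that \<open>norm w < \<rho>1\<close> by auto
      qed
      moreover have "proj w \<bullet> e = 0" using e by (simp add: proj_def inner_diff_left)
      ultimately show ?thesis by (auto simp: cylinder_base_def)
    qed
    have proj_norm: "norm (proj w) \<le> norm w" for w
    proof (rule power2_le_imp_le)
      have "(norm w)\<^sup>2 = (norm (proj w))\<^sup>2 + (w \<bullet> e)\<^sup>2"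
        using e unfolding power2_norm_eq_inner
        by (simp add: power2_eq_square proj_def inner_diff_left inner_diff_right inner_commute)
      then show "(norm (proj w))\<^sup>2 \<le> (norm w)\<^sup>2" using zero_le_power2[of "w \<bullet> e"] by linarith
      show "0 \<le> norm w" by (rule norm_ge_zero)
    qed
    have char: "x0 + R w \<in> E \<longleftrightarrow> w \<bullet> e < g (proj w)" if "norm w < \<rho>1" "norm w < \<rho>2" for w
    proof -
      have "\<bar>w \<bullet> e\<bar> < \<rho>2" using Basis_le_norm[OF e, of w] that by linarith
      then have "w \<bullet> e \<in> {- \<rho>2 <..< \<rho>2}" by (simp add: abs_less_iff)
      moreover have "proj w + (w \<bullet> e) *\<^sub>R e = w" by (simp add: proj_def)
      ultimately show ?thesis using sub proj_base[OF that(1)] by metis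
    qed
    obtain w where w: "R w = x - x0" using surjR by blast
    have nw: "norm w < \<eta>" using x0(2) normR[of w] w by (simp add: dist_norm)
    have "w \<bullet> e < g (proj w)" using char[of w] x w nw \<eta> by simp
    \<comment> \<open>A shift by \<tau> against the graph direction leads deeper below the graph,
      where the Lipschitz bound leaves room for a ball.\<close>
    define p where "p = x - R (\<tau> *\<^sub>R e)"
    have "ball p \<rho> \<subseteq> E"
    proof
      fix y assume y: "y \<in> ball p \<rho>"
      obtain w' where w': "R w' = y - x0" using surjR by blast
      define h where "h = w' - w + \<tau> *\<^sub>R e"
      have "R h = y - p"
        unfolding h_def p_def using w w' linR by (simp add: linear_add linear_diff)
      then have nh: "norm h < \<rho>" using y normR[of h] by (simp add: dist_norm norm_minus_commute)
      have w'h: "w' = w + h - \<tau> *\<^sub>R e" by (simp add: h_def)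
      have "norm w' \<le> norm (w + h) + norm (\<tau> *\<^sub>R e)" unfolding w'h by (rule norm_triangle_ineq4)
      also have "\<dots> \<le> norm w + norm h + \<tau>"
        using norm_triangle_ineq[of w h] e \<tau> by simp
      finally have nw': "norm w' < 3 * \<eta>" using nw nh \<rho> \<tau> by simp
      have "proj w' = proj w + proj h"
        using e by (simp add: proj_def w'h algebra_simps)
      then have "dist (proj w) (proj w') \<le> \<rho>"
        using proj_norm[of h] nh by (simp add: dist_norm)
      have "\<bar>g (proj w) - g (proj w')\<bar> \<le> L * dist (proj w) (proj w')"
        using lipschitz_onD[OF g proj_base proj_base, of w w'] nw nw' \<eta> by (simp add: dist_real_def)
      also have "\<dots> \<le> L * \<rho>" using \<open>dist (proj w) (proj w') \<le> \<rho>\<close> pos by simp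
      finally have "g (proj w) \<le> g (proj w') + L * \<rho>" by simp
      moreover have "w' \<bullet> e = w \<bullet> e + h \<bullet> e - \<tau>"
        using e by (simp add: w'h algebra_simps)
      moreover have "h \<bullet> e < \<rho>" using Basis_le_norm[OF e, of h] nh by simp
      ultimately have "w' \<bullet> e < g (proj w')" using \<open>w \<bullet> e < g (proj w)\<close> \<rho> by linarith
      then show "y \<in> E" using char[of w'] nw' \<eta> w' by simp
    qed
    moreover have "dist x p \<le> s"
      using normR[of "\<tau> *\<^sub>R e"] e \<tau> by (simp add: p_def dist_norm)
    ultimately show ?thesis by blast
  qed
  then show ?thesis using \<rho> \<tau> by (intro exI[of _ \<rho>]) auto
qed

section \<open>Chains in bounded sets\<close>

lemma separated_points_card_bound:
  fixes \<sigma> R :: real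
  assumes "\<sigma> > 0"
  shows "\<exists>N. \<forall>(p::'a::euclidean_space) I (f :: nat \<Rightarrow> 'a).
      (\<forall>i\<in>I. dist p (f i) \<le> R) \<longrightarrow>
      (\<forall>i\<in>I. \<forall>j\<in>I. i < j \<longrightarrow> dist (f i) (f j) > \<sigma>) \<longrightarrow> card I \<le> N"
proof -
  \<comment> \<open>Translating \<open>p\<close> to the origin puts every configuration into one
    compact ball, so a single finite cover by balls of radius \<sigma>/2 serves for all
    \<open>p\<close>; each of them holds at most one of the points.\<close>
  have "compact (cball (0::'a) R)" by simp
  then obtain k where k: "finite k" "cball (0::'a) R \<subseteq> (\<Union>x\<in>k. ball x (\<sigma> / 2))"
    using assms unfolding compact_eq_totally_bounded by (meson half_gt_zero)
  have bound: "card I \<le> card k"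
    if R: "\<And>i. i \<in> I \<Longrightarrow> dist p (f i) \<le> R"
      and sep: "\<And>i j. i \<in> I \<Longrightarrow> j \<in> I \<Longrightarrow> i < j \<Longrightarrow> dist (f i) (f j) > \<sigma>"
    for p :: 'a and I and f :: "nat \<Rightarrow> 'a"
  proof -
    have "\<exists>x\<in>k. dist x (f i - p) < \<sigma> / 2" if "i \<in> I" for i
    proof -
      have "f i - p \<in> cball 0 R" using R[OF that] by (simp add: dist_norm norm_minus_commute)
      then have "f i - p \<in> (\<Union>x\<in>k. ball x (\<sigma> / 2))" using k(2) by blast
      then show ?thesis by auto
    qed
    then obtain c where c: "\<And>i. i \<in> I \<Longrightarrow> c i \<in> k \<and> dist (c i) (f i - p) < \<sigma> / 2" by metis
    have "inj_on c I"
    proof (rule linorder_inj_onI)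
      fix i j assume ij: "i < j" "i \<in> I" "j \<in> I"
      show "c i \<noteq> c j"
      proof
        assume "c i = c j"
        then have "dist (f i - p) (f j - p) < \<sigma>"
          using c[OF ij(2)] c[OF ij(3)] dist_triangle_half_r by metis
        then show False using sep[OF ij(2,3,1)] by (simp add: dist_norm)
      qed
    qed auto
    then show ?thesis using c k(1) by (intro card_inj_on_le) auto
  qed
  show ?thesis
  proof (intro exI[of _ "card k"] allI impI)
    fix p :: 'a and I and f :: "nat \<Rightarrow> 'a"
    assume "\<forall>i\<in>I. dist p (f i) \<le> R" "\<forall>i\<in>I. \<forall>j\<in>I. i < j \<longrightarrow> dist (f i) (f j) > \<sigma>"
    then show "card I \<le> card k" using bound[of I p f] by blast
  qed
qed

text \<open>A shortest chain is separated: points with index distance at least 2 are more than a step apart.\<close>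

lemma bounded_chain_length:
  fixes \<sigma> R :: real
  assumes "\<sigma> > 0"
  shows "\<exists>N::nat. \<forall>(X :: 'a::euclidean_space set) p q. X \<subseteq> cball p R \<longrightarrow>
      (p, q) \<in> {(a, b). a \<in> X \<and> b \<in> X \<and> dist a b \<le> \<sigma>}\<^sup>* \<longrightarrow>
      (\<exists>n\<le>N. \<exists>f. f 0 = p \<and> f n = q \<and> (\<forall>i<n. f i \<in> X \<and> f (Suc i) \<in> X \<and> dist (f i) (f (Suc i)) \<le> \<sigma>))"
proof -
  obtain N where N: "\<forall>(p::'a) I (f :: nat \<Rightarrow> 'a). (\<forall>i\<in>I. dist p (f i) \<le> R) \<longrightarrow>
      (\<forall>i\<in>I. \<forall>j\<in>I. i < j \<longrightarrow> dist (f i) (f j) > \<sigma>) \<longrightarrow> card I \<le> N"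
    using separated_points_card_bound[OF assms] by blast
  have "\<exists>n\<le>2 * N. \<exists>f. f 0 = p \<and> f n = q \<and> (\<forall>i<n. f i \<in> X \<and> f (Suc i) \<in> X \<and> dist (f i) (f (Suc i)) \<le> \<sigma>)"
    if X: "X \<subseteq> cball p R" and chain: "(p, q) \<in> {(a, b). a \<in> X \<and> b \<in> X \<and> dist a b \<le> \<sigma>}\<^sup>*"
    for X :: "'a set" and p q
  proof -
    define Q where "Q = {(a, b). a \<in> X \<and> b \<in> X \<and> dist a b \<le> \<sigma>}"
    define n where "n = (LEAST n. (p, q) \<in> Q ^^ n)"
    have "(p, q) \<in> Q ^^ n"
      unfolding n_def using chain[folded Q_def] by (metis LeastI_ex rtrancl_power)
    then obtain f where f: "f 0 = p" "f n = q" "\<And>i. i < n \<Longrightarrow> (f i, f (Suc i)) \<in> Q"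
      unfolding relpow_fun_conv by blast
    have inX: "f i \<in> X" if "i < n" for i using f(3)[OF that] by (auto simp: Q_def)
    have sub: "(f i, f j) \<in> Q ^^ (j - i)" if "i \<le> j" "j \<le> n" for i j
      unfolding relpow_fun_conv
      using f(3) that by (intro exI[of _ "\<lambda>k. f (i + k)"]) auto
    \<comment> \<open>A direct step from \<open>f i\<close> to \<open>f j\<close> would give a chain
      of i + 1 + (n - j) links, fewer than \<open>n\<close>. The restriction j < n keeps
      \<open>f j\<close> in \<open>X\<close> by \<open>inX\<close>.\<close>
    have sep: "dist (f i) (f j) > \<sigma>" if "i + 2 \<le> j" "j < n" for i j
    proof (rule ccontr)
      assume "\<not> \<sigma> < dist (f i) (f j)"
      then have "(f i, f j) \<in> Q ^^ 1" using inX that by (simp add: Q_def)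
      then have "(p, q) \<in> Q ^^ (i + 1 + (n - j))"
        using sub[of 0 i] sub[of j n] f(1,2) that
        unfolding relpow_add by (simp, blast)
      then have "n \<le> i + 1 + (n - j)" unfolding n_def by (rule Least_le)
      then show False using that by linarith
    qed
    \<comment> \<open>Distinct even indices differ by at least 2, so the points
      \<open>f (2 * i)\<close> are pairwise separated; counting only these produces the factor 2 in
      the bound 2N.\<close>
    have "card {i. 2 * i < n} \<le> N"
    proof (rule N[rule_format, of _ p "\<lambda>i. f (2 * i)"])
      show "dist p (f (2 * i)) \<le> R" if "i \<in> {i. 2 * i < n}" for i
        using inX[of "2 * i"] that X by auto
      show "\<sigma> < dist (f (2 * i)) (f (2 * j))"
        if "i \<in> {i. 2 * i < n}" "j \<in> {i. 2 * i < n}" "i < j" for i j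
        using sep[of "2 * i" "2 * j"] that by simp
    qed
    moreover have "{i. 2 * i < n} = {..<(n + 1) div 2}" by auto
    ultimately have "n \<le> 2 * N" by simp
    moreover have "f i \<in> X \<and> f (Suc i) \<in> X \<and> dist (f i) (f (Suc i)) \<le> \<sigma>" if "i < n" for i
      using f(3)[OF that] by (auto simp: Q_def)
    ultimately show ?thesis using f(1,2) by blast
  qed
  then show ?thesis by blast
qed

section \<open>Connectedness at a bounded scale\<close>

locale separated_holes =
  fixes E :: "'a::euclidean_space set" and \<K> :: "'a set set" and D \<delta> :: real
  assumes open_E: "open E" and connected_E: "connected E"
    and holes: "- E = \<Union>\<K>"
    and compact_hole: "K \<in> \<K> \<Longrightarrow> compact K"
    and diameter_hole: "K \<in> \<K> \<Longrightarrow> x \<in> K \<Longrightarrow> y \<in> K \<Longrightarrow> dist x y \<le> D"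
    and D_nonneg: "D \<ge> 0" and \<delta>_pos: "\<delta> > 0"
    and separated: "K \<in> \<K> \<Longrightarrow> K' \<in> \<K> \<Longrightarrow> K \<noteq> K' \<Longrightarrow> x \<in> K \<Longrightarrow> y \<in> K' \<Longrightarrow> dist x y \<ge> \<delta>"
begin

lemma near_hole:
  assumes "K \<in> \<K>" "x \<in> K" "dist x y < \<delta>" "y \<notin> K"
  shows "y \<in> E"
proof (rule ccontr)
  assume "y \<notin> E"
  then obtain K' where "K' \<in> \<K>" "y \<in> K'" using holes by blast
  then show False using separated[of K K' x y] assms by force
qed

text \<open>The \<delta>-neighbourhoods of the remaining holes miss the chosen ones, so together
  with \<open>E\<close> they form the open complement. This covers infinite subfamilies as well, and
  it supplies the closed set that unicoherence asks for.\<close>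

lemma closed_Union_holes:
  assumes "\<M> \<subseteq> \<K>"
  shows "closed (\<Union>\<M>)"
proof -
  have "y \<in> - \<Union>\<M> \<longleftrightarrow> y \<in> E \<union> (\<Union>K\<in>\<K> - \<M>. \<Union>x\<in>K. ball x \<delta>)" for y
  proof (cases "y \<in> E")
    case True
    then show ?thesis using holes assms by blast
  next
    case False
    then obtain K where K: "K \<in> \<K>" "y \<in> K" using holes by blast
    have *: "K' = K" if "K' \<in> \<K>" "x \<in> K'" "dist x y < \<delta>" for K' x
      using separated[OF that(1) K(1) _ that(2) K(2)] that(3) by force
    have "y \<in> (\<Union>x\<in>K. ball x \<delta>)" using K \<delta>_pos by (intro UN_I[of y]) auto
    then have "y \<in> (\<Union>K\<in>\<K> - \<M>. \<Union>x\<in>K. ball x \<delta>) \<longleftrightarrow> K \<notin> \<M>"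
      using K(1) * by (metis (no_types, lifting) DiffD1 DiffD2 DiffI UN_E UN_I mem_ball)
    moreover have "y \<in> \<Union>\<M> \<longleftrightarrow> K \<in> \<M>"
      using K assms *[of _ y] \<delta>_pos by (metis UnionE UnionI dist_self subsetD)
    ultimately show ?thesis using False by blast
  qed
  then have "- \<Union>\<M> = E \<union> (\<Union>K\<in>\<K> - \<M>. \<Union>x\<in>K. ball x \<delta>)" by blast
  moreover have "open \<dots>" using open_E by (intro open_Un open_UN ballI open_ball)
  ultimately show ?thesis by (simp add: closed_def)
qed

text \<open>
  Let \<open>A\<close> be a ball about \<open>a\<close> together with a neighbourhood of the holes that it meets. Neither the
  complement of \<open>A\<close> nor the union of these holes separates \<open>a\<close> from \<open>b\<close>, hence neither does their
  disjoint union, whose complement is the bounded set \<open>A \<inter> E\<close>.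
\<close>

lemma connected_component_within_ball:
  assumes a: "a \<in> E" and b: "b \<in> E" and ab: "dist a b < R"
  shows "connected_component (E \<inter> ball a (R + D + \<delta>)) a b"
proof -
  define \<M> where "\<M> = {K \<in> \<K>. K \<inter> ball a R \<noteq> {}}"
  define A where "A = ball a R \<union> (\<Union>K\<in>\<M>. \<Union>x\<in>K. ball x (\<delta> / 2))"
  have "R > 0" using ab zero_le_dist[of a b] by linarith
  have sub: "\<M> \<subseteq> \<K>" by (auto simp: \<M>_def)
  have "open A" unfolding A_def by (intro open_Un open_UN ballI open_ball)
  have "\<Union>\<M> \<subseteq> A" 
  proof
    fix x assume "x \<in> \<Union>\<M>"
    moreover have "x \<in> ball x (\<delta> / 2)" using \<delta>_pos by simp
    ultimately show "x \<in> A" unfolding A_def by blast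
  qed
  have E_sub: "E \<subseteq> - \<Union>\<M>" using holes sub by blast
  have "connected_component (- (\<Union>\<M> \<union> (- A))) a b"
  proof (rule separation_by_Un_closed_pointwise)
    show "closed (\<Union>\<M>)" using sub by (rule closed_Union_holes)
    show "closed (- A)" using \<open>open A\<close> by auto
    show "\<Union>\<M> \<inter> - A = {}" using \<open>\<Union>\<M> \<subseteq> A\<close> by blast
    show "connected_component (- \<Union>\<M>) a b"
      using connected_E E_sub a b by (auto simp: connected_component_def)
    show "connected_component (- (- A)) a b"
      unfolding connected_component_def
      using ab \<open>R > 0\<close> by (intro exI[of _ "ball a R"]) (auto simp: A_def)
  qed
  \<comment> \<open>Every hole that meets \<open>ball a R\<close> belongs to \<open>\<M>\<close>, so
    removing these leaves only points of \<open>E\<close> there; close to a hole of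
    \<open>\<M>\<close>, \<open>near_hole\<close> excludes all others. The radius is made up of R to
    reach a hole, D to cross it and less than \<delta> to leave it.\<close>
  moreover have "- (\<Union>\<M> \<union> (- A)) \<subseteq> E \<inter> ball a (R + D + \<delta>)"
  proof
    fix y assume y: "y \<in> - (\<Union>\<M> \<union> (- A))"
    then consider "y \<in> ball a R" | K x where "K \<in> \<M>" "x \<in> K" "dist x y < \<delta> / 2"
      by (auto simp: A_def)
    then show "y \<in> E \<inter> ball a (R + D + \<delta>)"
    proof cases
      case 1
      then have "y \<in> E" using y holes unfolding \<M>_def by blast
      then show ?thesis using 1 D_nonneg \<delta>_pos by simp
    next
      case 2
      then have "y \<in> E" using y near_hole[of K x y] sub \<delta>_pos by auto
      obtain z where z: "z \<in> K" "dist a z < R" using 2 by (auto simp: \<M>_def)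
      have "dist z x \<le> D" using diameter_hole 2 z sub by blast
      then have "dist a y < R + D + \<delta>"
        using z 2 dist_triangle[of a y z] dist_triangle[of z y x] \<delta>_pos by linarith
      then show ?thesis using \<open>y \<in> E\<close> by simp
    qed
  qed
  ultimately show ?thesis by (rule connected_component_of_subset)
qed

text \<open>A ball of radius D + 1 about a point of a hole is too large for the hole and meets its
  frontier; a move of less than \<delta> across the frontier leaves this hole and cannot enter
  another. The auxiliary point at distance D + 1/2 is outside the hole but still in that
  ball.\<close>

lemma near_E:
  "\<exists>p\<in>E. dist x p \<le> D + 1 + \<delta>"
proof (cases "x \<in> E")
  case True
  then show ?thesis using \<delta>_pos D_nonneg by (intro bexI[of _ x]) auto
next
  case False
  then obtain K where K: "K \<in> \<K>" "x \<in> K" using holes by blast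
  obtain e :: 'a where "e \<in> Basis" using nonempty_Basis by blast
  define w where "w = x + (D + 1/2) *\<^sub>R e"
  have "dist x w = D + 1/2" using \<open>e \<in> Basis\<close> D_nonneg by (simp add: w_def dist_norm)
  then have "w \<notin> K" using diameter_hole[OF K, of w] by auto
  have "ball x (D + 1) \<inter> frontier K \<noteq> {}"
  proof (rule connected_Int_frontier)
    show "ball x (D + 1) \<inter> K \<noteq> {}" using K D_nonneg by force
    show "ball x (D + 1) - K \<noteq> {}" using \<open>w \<notin> K\<close> \<open>dist x w = D + 1/2\<close> by force
  qed auto
  then obtain z where z: "dist x z < D + 1" "z \<in> frontier K" by auto
  have "z \<in> K" using z(2) compact_hole[OF K(1)] frontier_subset_compact by blast
  obtain y where y: "dist z y < \<delta>" "y \<notin> K"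
    using z(2) \<delta>_pos unfolding frontier_straddle by blast
  have "y \<in> E" using near_hole[OF K(1) \<open>z \<in> K\<close> y] .
  moreover have "dist x y \<le> D + 1 + \<delta>" using dist_triangle[of x y z] z y by linarith
  ultimately show ?thesis by blast
qed

text \<open>A connected set in a bounded part of \<open>E\<close> joins the two centres. Its points
  need not be centres of balls in \<open>E\<close>, but each lies within \<open>s\<close> of one;
  passing to these centres gives a chain in a bounded set \<open>X\<close>, which can then be
  shortened to a uniform length.\<close>

lemma bounded_ball_chains:
  fixes \<rho> s R :: real
  assumes near: "\<And>x. x \<in> E \<Longrightarrow> \<exists>p. ball p \<rho> \<subseteq> E \<and> dist x p \<le> s"
    and pos: "\<rho> > 0" "s > 0" "R > 0"
  shows "\<exists>N::nat. \<forall>p q. ball p \<rho> \<subseteq> E \<longrightarrow> ball q \<rho> \<subseteq> E \<longrightarrow> dist p q < R \<longrightarrow>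
    (\<exists>n\<le>N. \<exists>f. f 0 = p \<and> f n = q \<and>
      (\<forall>i\<le>n. ball (f i) \<rho> \<subseteq> E \<and> dist p (f i) \<le> R + D + \<delta> + s) \<and>
      (\<forall>i<n. dist (f i) (f (Suc i)) \<le> 4 * s))"
proof -
  define R' where "R' = R + D + \<delta> + s"
  have "0 \<le> R'" using pos D_nonneg \<delta>_pos by (simp add: R'_def)
  obtain N :: nat where N: "\<forall>(X :: 'a set) p q. X \<subseteq> cball p R' \<longrightarrow>
      (p, q) \<in> {(a, b). a \<in> X \<and> b \<in> X \<and> dist a b \<le> 4 * s}\<^sup>* \<longrightarrow>
      (\<exists>n\<le>N. \<exists>f. f 0 = p \<and> f n = q \<and> (\<forall>i<n. f i \<in> X \<and> f (Suc i) \<in> X \<and> dist (f i) (f (Suc i)) \<le> 4 * s))"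
    using bounded_chain_length[of "4 * s" R'] pos by auto
  have "\<exists>n\<le>N. \<exists>f. f 0 = p \<and> f n = q \<and>
      (\<forall>i\<le>n. ball (f i) \<rho> \<subseteq> E \<and> dist p (f i) \<le> R') \<and>
      (\<forall>i<n. dist (f i) (f (Suc i)) \<le> 4 * s)"
    if p: "ball p \<rho> \<subseteq> E" and q: "ball q \<rho> \<subseteq> E" and pq: "dist p q < R" for p q
  proof -
    define X where "X = {c. ball c \<rho> \<subseteq> E} \<inter> cball p R'"
    define Q where "Q = {(a, b). a \<in> X \<and> b \<in> X \<and> dist a b \<le> 4 * s}"
    have "p \<in> E" "q \<in> E" using p q pos(1) centre_in_ball by blast+
    then obtain T where T: "connected T" "T \<subseteq> E \<inter> ball p (R + D + \<delta>)" "p \<in> T" "q \<in> T"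
      using connected_component_within_ball[OF _ _ pq] unfolding connected_component_def by blast
    have pX: "p \<in> X" using p \<open>0 \<le> R'\<close> by (simp add: X_def)
    have qX: "q \<in> X" using q pq D_nonneg \<delta>_pos pos by (simp add: X_def R'_def)
    \<comment> \<open>Quantifying over all centres within \<open>s\<close> of \<open>w\<close> makes
      \<open>reach\<close> independent of any choice of centre, so that it propagates along the
      connected set \<open>T\<close>.\<close>
    define reach where "reach w \<longleftrightarrow> (\<forall>c\<in>X. dist w c \<le> s \<longrightarrow> (p, c) \<in> Q\<^sup>*)" for w
    have "reach q"
    proof (rule connected_induction_simple[OF T(1,3,4)])
      show "reach p" using pX pos by (auto simp: Q_def reach_def)
    next
      fix a assume a: "a \<in> T"
      \<comment> \<open>Two points of \<open>ball a s\<close> are less than 2s apart, and passing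
        from each to its centre adds at most s: hence the step 4s. One such passage is also the last
        \<open>s\<close> in R'.\<close>
      have step: "reach y" if x: "x \<in> T \<inter> ball a s" and y: "y \<in> T \<inter> ball a s" and "reach x" for x y
        unfolding reach_def
      proof (intro ballI impI)
        fix c assume c: "c \<in> X" "dist y c \<le> s"
        obtain c' where c': "ball c' \<rho> \<subseteq> E" "dist x c' \<le> s" using near[of x] x T(2) by blast
        have "dist p x < R + D + \<delta>" using x T(2) by auto
        then have "c' \<in> X"
          using c' dist_triangle[of p c' x] by (simp add: X_def R'_def)
        have "dist c' c \<le> 4 * s"
          using x y c c' dist_triangle[of c' c x] dist_triangle[of x c y] dist_triangle[of x y a]
          by (simp add: dist_commute)
        then have "(c', c) \<in> Q" using \<open>c' \<in> X\<close> c by (simp add: Q_def)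
        moreover have "(p, c') \<in> Q\<^sup>*" using \<open>reach x\<close> \<open>c' \<in> X\<close> c' by (simp add: reach_def)
        ultimately show "(p, c) \<in> Q\<^sup>*" by simp
      qed
      have "openin (top_of_set T) (T \<inter> ball a s)" by (rule openin_open_Int) simp
      moreover have "a \<in> T \<inter> ball a s" using a pos(2) by simp
      ultimately show "\<exists>U. openin (top_of_set T) U \<and> a \<in> U \<and> (\<forall>x\<in>U. \<forall>y\<in>U. reach x \<longrightarrow> reach y)"
        using step by blast
    qed
    then have "(p, q) \<in> Q\<^sup>*" using qX pos by (simp add: reach_def)
    moreover have "X \<subseteq> cball p R'" by (simp add: X_def)
    ultimately have "\<exists>n\<le>N. \<exists>f. f 0 = p \<and> f n = q \<and>
        (\<forall>i<n. f i \<in> X \<and> f (Suc i) \<in> X \<and> dist (f i) (f (Suc i)) \<le> 4 * s)"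
      unfolding Q_def by (intro N[rule_format])
    then obtain n f where f: "n \<le> N" "f 0 = p" "f n = q"
      "\<forall>i<n. f i \<in> X \<and> f (Suc i) \<in> X \<and> dist (f i) (f (Suc i)) \<le> 4 * s"
      by blast
    have "f i \<in> X" if "i \<le> n" for i
      using f pX qX that by (cases "i = n") auto
    then have "\<forall>i\<le>n. ball (f i) \<rho> \<subseteq> E \<and> dist p (f i) \<le> R'" by (simp add: X_def)
    then show ?thesis using f by blast
  qed
  then show ?thesis unfolding R'_def by blast
qed
end

section \<open>Means over balls\<close>

text \<open>The map \<open>h\<close> is arbitrary: rounding to the integer lattice takes countably
  many values, each on a Borel set, so every function of the rounded point is measurable.\<close>

lemma borel_measurable_lattice_step:
  fixes h :: "'a::euclidean_space \<Rightarrow> 'a"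
  shows "(\<lambda>x. h (\<Sum>b\<in>Basis. of_int \<lfloor>x \<bullet> b\<rfloor> *\<^sub>R b)) \<in> borel_measurable borel"
proof -
  define cell where "cell x = (\<Sum>b\<in>Basis. of_int \<lfloor>x \<bullet> b\<rfloor> *\<^sub>R b)" for x :: 'a
  have meas: "cell \<in> borel_measurable borel" unfolding cell_def by measurable
  have "range cell \<subseteq> (\<lambda>k. \<Sum>b\<in>Basis. of_int (k b) *\<^sub>R b) ` (Basis \<rightarrow>\<^sub>E (UNIV :: int set))"
  proof
    fix y assume "y \<in> range cell"
    then obtain x where "y = cell x" by blast
    then show "y \<in> (\<lambda>k. \<Sum>b\<in>Basis. of_int (k b) *\<^sub>R b) ` (Basis \<rightarrow>\<^sub>E (UNIV :: int set))"
      by (intro image_eqI[of _ _ "\<lambda>b\<in>Basis. \<lfloor>x \<bullet> b\<rfloor>"]) (auto simp: cell_def)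
  qed
  then have count: "countable (range cell)"
    by (rule countable_subset) (intro countable_image countable_PiE, auto)
  have cell: "cell \<in> measurable borel (count_space (range cell))"
    unfolding measurable_count_space_eq_countable[OF count]
  proof (intro conjI ballI)
    show "cell \<in> space borel \<rightarrow> range cell" by simp
    show "cell -` {a} \<inter> space borel \<in> sets borel" for a
      using measurable_sets[OF meas, of "{a}"] by simp
  qed
  have "(\<lambda>x. h (cell x)) \<in> borel_measurable borel"
    by (rule measurable_compose_countable'[where f = "\<lambda>c _. h c", OF _ cell count]) simp
  then show ?thesis by (simp add: cell_def)
qed

lemma dist_lattice_point_le:
  fixes x :: "'a::euclidean_space"
  shows "dist x (\<Sum>b\<in>Basis. of_int \<lfloor>x \<bullet> b\<rfloor> *\<^sub>R b) \<le> DIM('a)"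
proof -
  have "x - (\<Sum>b\<in>Basis. of_int \<lfloor>x \<bullet> b\<rfloor> *\<^sub>R b) = (\<Sum>b\<in>Basis. (x \<bullet> b - of_int \<lfloor>x \<bullet> b\<rfloor>) *\<^sub>R b)"
    by (simp add: scaleR_diff_left sum_subtractf euclidean_representation)
  also have "norm \<dots> \<le> (\<Sum>b\<in>(Basis::'a set). 1)"
  proof (rule sum_norm_le)
    fix b :: 'a assume "b \<in> Basis"
    then show "norm ((x \<bullet> b - of_int \<lfloor>x \<bullet> b\<rfloor>) *\<^sub>R b) \<le> 1"
      by simp linarith
  qed
  finally show ?thesis by (simp add: dist_norm)
qed

text \<open>A choice of centre made separately at every point may fail to be measurable. Choosing at
  lattice points only repairs this, and the dimension bounds the extra displacement.\<close>

lemma measurable_ball_centres: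
  fixes E :: "'a::euclidean_space set"
  assumes "\<And>x. \<exists>p. ball p \<rho> \<subseteq> E \<and> dist x p \<le> M"
  shows "\<exists>P\<in>borel_measurable borel. \<forall>x. ball (P x) \<rho> \<subseteq> E \<and> dist x (P x) \<le> M + DIM('a)"
proof -
  obtain h where h: "\<And>x. ball (h x) \<rho> \<subseteq> E \<and> dist x (h x) \<le> M" using assms by metis
  let ?c = "\<lambda>x::'a. \<Sum>b\<in>Basis. of_int \<lfloor>x \<bullet> b\<rfloor> *\<^sub>R b"
  have "dist x (h (?c x)) \<le> M + DIM('a)" for x
    using h[of "?c x"] dist_lattice_point_le[of x] dist_triangle[of x "h (?c x)" "?c x"] by linarith
  then show ?thesis using h by (intro bexI[OF _ borel_measurable_lattice_step[of h]] allI conjI) simp_all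
qed

section \<open>Jensen-type estimates for means\<close>

definition mean_on :: "'a::euclidean_space set \<Rightarrow> ('a \<Rightarrow> real) \<Rightarrow> real" where
  "mean_on B u = (LINT x|lborel. indicator B x * u x) / measure lborel B"

text \<open>Jensen's inequality for the square: (u - a)^2 lies above its tangent at the mean, and
  the linear part of the tangent integrates to 0 over \<open>B\<close>. Square integrability on a
  set of finite measure supplies the integrability of \<open>u\<close>.\<close>

lemma mean_on_deviation:
  fixes u :: "'a::euclidean_space \<Rightarrow> real"
  assumes [measurable]: "B \<in> sets borel" "u \<in> borel_measurable borel"
    and fin: "emeasure lborel B < \<infinity>" and pos: "measure lborel B > 0"
    and sq: "(\<integral>\<^sup>+x\<in>B. ennreal ((u x)\<^sup>2) \<partial>lborel) < \<infinity>"
  shows "ennreal (measure lborel B * (mean_on B u - a)\<^sup>2) \<le> (\<integral>\<^sup>+x\<in>B. ennreal ((u x - a)\<^sup>2) \<partial>lborel)"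
proof -
  define m where "m = mean_on B u"
  have int1: "integrable lborel (\<lambda>x. indicator B x :: real)"
    using fin by (simp add: integrable_indicator_iff)
  have int2: "integrable lborel (\<lambda>x. indicator B x * (u x)\<^sup>2)"
  proof (rule integrableI_nonneg)
    show "(\<integral>\<^sup>+x. ennreal (indicator B x * (u x)\<^sup>2) \<partial>lborel) < \<infinity>"
      using sq by (simp add: ennreal_mult' ennreal_indicator mult.commute)
  qed auto
  have intu: "integrable lborel (\<lambda>x. indicator B x * u x)"
  proof (rule Bochner_Integration.integrable_bound[OF Bochner_Integration.integrable_add[OF int1 int2]])
    have "\<bar>t\<bar> \<le> 1 + t\<^sup>2" for t :: real
      using sum_squares_bound[of "\<bar>t\<bar>" 1] zero_le_power2[of t] by (simp add: power2_eq_square) 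
    then show "AE x in lborel. norm (indicator B x * u x) \<le> norm (indicator B x + indicator B x * (u x)\<^sup>2)"
      by (auto simp: indicator_def) 
  qed auto
  have lin: "(LINT x|lborel. (m - a)\<^sup>2 * indicator B x + 2 * (m - a) * (indicator B x * u x - m * indicator B x))
      = measure lborel B * (m - a)\<^sup>2"
  proof -
    have "(LINT x|lborel. indicator B x * u x) = m * measure lborel B"
      using pos by (simp add: m_def mean_on_def)
    then show ?thesis using int1 intu by simp
  qed
  have int3: "integrable lborel (\<lambda>x. indicator B x * (u x - a)\<^sup>2)"
  proof -
    have "integrable lborel (\<lambda>x. indicator B x * (u x)\<^sup>2 - 2 * a * (indicator B x * u x) + a\<^sup>2 * indicator B x)"
      using int1 int2 intu by simp
    then show ?thesis by (simp add: power2_eq_square algebra_simps)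
  qed
  have "measure lborel B * (m - a)\<^sup>2 \<le> (LINT x|lborel. indicator B x * (u x - a)\<^sup>2)"
    unfolding lin[symmetric]
  proof (rule integral_mono)
    fix x
    have "(m - a)\<^sup>2 + 2 * (m - a) * (u x - m) \<le> (u x - a)\<^sup>2"
      using zero_le_power2[of "u x - m"] by (simp add: power2_eq_square algebra_simps)
    then show "(m - a)\<^sup>2 * indicator B x + 2 * (m - a) * (indicator B x * u x - m * indicator B x)
        \<le> indicator B x * (u x - a)\<^sup>2"
      by (simp add: indicator_def)
  qed (use int1 intu int3 in simp_all)
  then have "ennreal (measure lborel B * (m - a)\<^sup>2) \<le> ennreal (LINT x|lborel. indicator B x * (u x - a)\<^sup>2)"
    by (rule ennreal_leI)
  also have "\<dots> = (\<integral>\<^sup>+x. ennreal (indicator B x * (u x - a)\<^sup>2) \<partial>lborel)"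
    using int3 by (intro nn_integral_eq_integral[symmetric]) auto
  also have "\<dots> = (\<integral>\<^sup>+x\<in>B. ennreal ((u x - a)\<^sup>2) \<partial>lborel)"
    by (simp add: ennreal_mult' ennreal_indicator mult.commute)
  finally show ?thesis by (simp add: m_def)
qed

text \<open>\<open>mean_on_deviation\<close> is used twice: over \<open>B\<close> with the constant
  \<open>mean_on B' u\<close>, then over \<open>B'\<close> with the constant \<open>u x\<close> for
  each fixed \<open>x\<close>.\<close>

lemma mean_on_difference:
  fixes u :: "'a::euclidean_space \<Rightarrow> real"
  assumes [measurable]: "B \<in> sets borel" "B' \<in> sets borel" "u \<in> borel_measurable borel"
    and B: "emeasure lborel B < \<infinity>" "measure lborel B > 0" "(\<integral>\<^sup>+x\<in>B. ennreal ((u x)\<^sup>2) \<partial>lborel) < \<infinity>"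
    and B': "emeasure lborel B' < \<infinity>" "measure lborel B' > 0" "(\<integral>\<^sup>+x\<in>B'. ennreal ((u x)\<^sup>2) \<partial>lborel) < \<infinity>"
  shows "ennreal (measure lborel B * measure lborel B' * (mean_on B u - mean_on B' u)\<^sup>2)
    \<le> (\<integral>\<^sup>+x\<in>B. (\<integral>\<^sup>+y\<in>B'. ennreal ((u y - u x)\<^sup>2) \<partial>lborel) \<partial>lborel)"
proof -
  have "ennreal (measure lborel B * measure lborel B' * (mean_on B u - mean_on B' u)\<^sup>2)
      = ennreal (measure lborel B') * ennreal (measure lborel B * (mean_on B u - mean_on B' u)\<^sup>2)"
    by (simp add: ennreal_mult'[symmetric] mult_ac)
  also have "\<dots> \<le> ennreal (measure lborel B') * (\<integral>\<^sup>+x\<in>B. ennreal ((u x - mean_on B' u)\<^sup>2) \<partial>lborel)"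
    using B by (intro mult_left_mono mean_on_deviation) auto
  also have "\<dots> = (\<integral>\<^sup>+x. ennreal (measure lborel B') * (ennreal ((u x - mean_on B' u)\<^sup>2) * indicator B x) \<partial>lborel)"
    by (rule nn_integral_cmult[symmetric]) measurable
  also have "\<dots> \<le> (\<integral>\<^sup>+x\<in>B. (\<integral>\<^sup>+y\<in>B'. ennreal ((u y - u x)\<^sup>2) \<partial>lborel) \<partial>lborel)"
  proof (rule nn_integral_mono)
    fix x
    have "ennreal (measure lborel B') * ennreal ((u x - mean_on B' u)\<^sup>2)
        = ennreal (measure lborel B' * (mean_on B' u - u x)\<^sup>2)"
      by (simp add: ennreal_mult'[symmetric] power2_commute)
    also have "\<dots> \<le> (\<integral>\<^sup>+y\<in>B'. ennreal ((u y - u x)\<^sup>2) \<partial>lborel)"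
      using B' by (intro mean_on_deviation) auto
    finally show "ennreal (measure lborel B') * (ennreal ((u x - mean_on B' u)\<^sup>2) * indicator B x)
        \<le> (\<integral>\<^sup>+y\<in>B'. ennreal ((u y - u x)\<^sup>2) \<partial>lborel) * indicator B x"
      by (auto simp: indicator_def)
  qed
  finally show ?thesis .
qed

section \<open>Measurability and convolution with balls\<close>

lemma borel_balls [measurable]:
  fixes c :: "'a::euclidean_space"
  shows "ball c r \<in> sets borel" "cball c r \<in> sets borel"
  by simp_all

lemma diff_mem_cball: "x - y \<in> cball 0 r \<longleftrightarrow> dist x y \<le> r"
  for x y :: "'a::real_normed_vector"
  by (simp add: dist_norm norm_minus_commute)

text \<open>All balls of radius \<rho> have one volume, so only the integral depends on
  \<open>p\<close>; writing the indicator as a function of p - w makes the integrand jointly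
  measurable.\<close>

lemma borel_measurable_mean_on_ball:
  fixes u :: "'a::euclidean_space \<Rightarrow> real"
  assumes [measurable]: "u \<in> borel_measurable borel" and "\<rho> > 0"
  shows "(\<lambda>p. mean_on (ball p \<rho>) u) \<in> borel_measurable borel"
proof -
  define V where "V = \<rho> ^ DIM('a) * measure lborel (ball (0::'a) 1)"
  have "measure lborel (ball p \<rho>) = V" for p :: 'a
    using content_ball_conv_unit_ball[of \<rho> p] assms(2) by (simp add: V_def)
  moreover have "indicator (ball p \<rho>) w = (indicator (ball 0 \<rho>) (p - w) :: real)" for p w :: 'a
    by (simp add: indicator_def dist_norm norm_minus_commute)
  ultimately have "mean_on (ball p \<rho>) u = (LINT w|lborel. indicator (ball 0 \<rho>) (p - w) * u w) / V" for p
    by (simp add: mean_on_def)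
  moreover have [measurable]: "u \<in> borel_measurable lborel" by simp
  have "(\<lambda>p. LINT w|lborel. indicator (ball 0 \<rho>) (p - w) * u w) \<in> borel_measurable borel"
    by measurable
  ultimately show ?thesis by simp
qed

text \<open>Integrating out the free variable gives the volume of a ball, the same for all centres;
  the second form follows by Fubini and the symmetry of the ball. Both are used because a pair is
  charged to the local energies at both of its points.\<close>

lemma nn_integral_convolution_cball:
  fixes h :: "'a::euclidean_space \<Rightarrow> ennreal"
  assumes [measurable]: "h \<in> borel_measurable borel" and r: "r \<ge> 0"
  shows "(\<integral>\<^sup>+x. \<integral>\<^sup>+y. h x * indicator (cball 0 r) (x - y) \<partial>lborel \<partial>lborel)
      = ennreal (r ^ DIM('a) * measure lborel (ball (0::'a) 1)) * (\<integral>\<^sup>+x. h x \<partial>lborel)" (is ?fst)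
    and "(\<integral>\<^sup>+x. \<integral>\<^sup>+y. h y * indicator (cball 0 r) (x - y) \<partial>lborel \<partial>lborel)
      = ennreal (r ^ DIM('a) * measure lborel (ball (0::'a) 1)) * (\<integral>\<^sup>+x. h x \<partial>lborel)" (is ?snd)
proof -
  have vol: "emeasure lborel (cball x r) = ennreal (r ^ DIM('a) * measure lborel (ball (0::'a) 1))" for x :: 'a
    using emeasure_lborel_cball_finite[of x r] content_cball_conv_ball[of x r] content_ball_conv_unit_ball[OF r, of x]
    by (simp add: emeasure_eq_ennreal_measure)
  have ind: "indicator (cball 0 r) (x - y) = (indicator (cball x r) y :: ennreal)" for x y :: 'a
    by (simp add: indicator_def dist_norm norm_minus_commute)
  have sym: "indicator (cball 0 r) (x - y) = (indicator (cball 0 r) (y - x) :: ennreal)" for x y :: 'a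
    by (simp add: indicator_def norm_minus_commute[of x y])
  have "(\<integral>\<^sup>+y. h x * indicator (cball 0 r) (x - y) \<partial>lborel)
      = ennreal (r ^ DIM('a) * measure lborel (ball (0::'a) 1)) * h x" for x
    by (simp add: ind nn_integral_cmult_indicator vol mult.commute)
  then show 1: ?fst by (simp add: nn_integral_cmult)
  have "(\<integral>\<^sup>+x. \<integral>\<^sup>+y. h y * indicator (cball 0 r) (x - y) \<partial>lborel \<partial>lborel)
      = (\<integral>\<^sup>+y. \<integral>\<^sup>+x. h y * indicator (cball 0 r) (x - y) \<partial>lborel \<partial>lborel)"
    by (rule lborel_pair.Fubini') measurable
  also have "\<dots> = (\<integral>\<^sup>+x. \<integral>\<^sup>+y. h x * indicator (cball 0 r) (x - y) \<partial>lborel \<partial>lborel)"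
    by (subst sym) simp
  finally show ?snd using 1 by simp
qed

section \<open>Filling the holes\<close>

text \<open>The cut-off in \<open>x\<close> makes it vanish off \<open>S\<close>, so it can be
  integrated over the whole space. The factor 1/\<epsilon>^2, common to both sides of the energy
  inequality, is left out until the end.\<close>

definition local_energy :: "'a::euclidean_space set \<Rightarrow> real \<Rightarrow> ('a \<Rightarrow> real) \<Rightarrow> 'a \<Rightarrow> ennreal" where
  "local_energy S r w x = (\<integral>\<^sup>+y. ennreal ((w y - w x)\<^sup>2) *
     (indicator S x * indicator S y * indicator (cball 0 r) (x - y)) \<partial>lborel)"

definition pair_energy :: "'a::euclidean_space set \<Rightarrow> real \<Rightarrow> ('a \<Rightarrow> real) \<Rightarrow> ennreal" where
  "pair_energy S r w = (\<integral>\<^sup>+x. local_energy S r w x \<partial>lborel)"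

lemma borel_measurable_local_energy:
  fixes w :: "'a::euclidean_space \<Rightarrow> real"
  assumes [measurable]: "S \<in> sets borel" "w \<in> borel_measurable borel"
  shows "local_energy S r w \<in> borel_measurable borel"
  unfolding local_energy_def by measurable

text \<open>
  Here \<open>F = \<epsilon> E\<close>, \<open>A\<close> is the inner part of \<open>\<Omega>\<close>, and \<open>P x\<close> is the centre of the ball whose mean
  is used as the value at a point \<open>x\<close> of a hole.
\<close>

locale hole_filling =
  fixes F \<Omega> A :: "'a::euclidean_space set" and \<rho> M R r\<^sub>0 r :: real and N :: nat
    and P :: "'a \<Rightarrow> 'a" and u :: "'a \<Rightarrow> real"
  assumes open_F: "open F" and open_\<Omega>: "open \<Omega>" and open_A: "open A"
    and \<rho>_pos: "\<rho> > 0" and r_nonneg: "r \<ge> 0" and R_nonneg: "R \<ge> 0" and M_nonneg: "M \<ge> 0"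
    and u_borel [measurable]: "u \<in> borel_measurable borel"
    and u_square: "(\<integral>\<^sup>+x\<in>\<Omega> \<inter> F. ennreal ((u x)\<^sup>2) \<partial>lborel) < \<infinity>"
    and near: "x \<in> F \<Longrightarrow> \<exists>p. ball p \<rho> \<subseteq> F \<and> dist x p + \<rho> \<le> r\<^sub>0 \<and> dist x p \<le> M"
    and P_borel [measurable]: "P \<in> borel_measurable borel"
    and P_ball: "ball (P x) \<rho> \<subseteq> F" and P_dist: "dist x (P x) \<le> M"
    and chain: "ball p \<rho> \<subseteq> F \<Longrightarrow> ball q \<rho> \<subseteq> F \<Longrightarrow> dist p q \<le> r + 2 * M \<Longrightarrow>
      \<exists>n\<le>N. \<exists>f. f 0 = p \<and> f n = q \<and> (\<forall>i\<le>n. ball (f i) \<rho> \<subseteq> F \<and> dist p (f i) \<le> R) \<and>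
        (\<forall>i<n. dist (f i) (f (Suc i)) + 2 * \<rho> \<le> r\<^sub>0)"
    and deep: "x \<in> A \<Longrightarrow> ball x (M + R + \<rho>) \<subseteq> \<Omega>"
begin

abbreviation "S \<equiv> \<Omega> \<inter> F"

definition "\<omega> = \<rho> ^ DIM('a) * measure lborel (ball (0::'a) 1)"

definition "m p = mean_on (ball p \<rho>) u"

text \<open>Off \<open>A\<close> the ball about \<open>P x\<close> may leave \<Omega>, where
  \<open>u\<close> carries no information. The value 0 does not affect the energy, which is
  estimated on \<open>A\<close> only, and keeps \<open>v\<close> square integrable on all of
  \<Omega>.\<close>

definition "v x = (if x \<in> S then u x else if x \<in> A then m (P x) else 0)"

lemma S_borel [measurable]: "S \<in> sets borel"
  using open_\<Omega> open_F by auto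

lemma A_borel [measurable]: "A \<in> sets borel"
  using open_A by auto

lemma local_energy_borel [measurable]: "local_energy S r\<^sub>0 u \<in> borel_measurable borel"
  by (rule borel_measurable_local_energy) measurable

lemma m_borel [measurable]: "m \<in> borel_measurable borel"
  unfolding m_def[abs_def] using borel_measurable_mean_on_ball[OF u_borel \<rho>_pos] .

lemma v_borel [measurable]: "v \<in> borel_measurable borel"
  unfolding v_def[abs_def] by measurable

lemma \<omega>_pos: "\<omega> > 0"
  using \<rho>_pos content_ball_pos[of 1 "0::'a"] by (simp add: \<omega>_def)

lemma measure_ball_\<rho>: "measure lborel (ball p \<rho>) = \<omega>" for p :: 'a
  using content_ball_conv_unit_ball[of \<rho> p] \<rho>_pos by (simp add: \<omega>_def)

lemma square_integral_ball:
  assumes "B \<subseteq> S"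
  shows "(\<integral>\<^sup>+x\<in>B. ennreal ((u x)\<^sup>2) \<partial>lborel) < \<infinity>"
proof -
  have "(\<integral>\<^sup>+x\<in>B. ennreal ((u x)\<^sup>2) \<partial>lborel) \<le> (\<integral>\<^sup>+x\<in>S. ennreal ((u x)\<^sup>2) \<partial>lborel)"
    using assms by (intro nn_integral_mono) (auto simp: indicator_def)
  then show ?thesis using u_square by (rule le_less_trans)
qed

lemma mean_deviation:
  assumes "ball p \<rho> \<subseteq> S"
  shows "ennreal (\<omega> * (m p - a)\<^sup>2) \<le> (\<integral>\<^sup>+x\<in>ball p \<rho>. ennreal ((u x - a)\<^sup>2) \<partial>lborel)"
  using mean_on_deviation[of "ball p \<rho>" u a] square_integral_ball[OF assms] \<omega>_pos
    emeasure_lborel_ball_finite[of p \<rho>]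
  by (simp add: measure_ball_\<rho> m_def)

lemma mean_difference:
  assumes "ball p \<rho> \<subseteq> S" "ball q \<rho> \<subseteq> S"
  shows "ennreal (\<omega>\<^sup>2 * (m p - m q)\<^sup>2)
    \<le> (\<integral>\<^sup>+x\<in>ball p \<rho>. (\<integral>\<^sup>+y\<in>ball q \<rho>. ennreal ((u y - u x)\<^sup>2) \<partial>lborel) \<partial>lborel)"
  using mean_on_difference[of "ball p \<rho>" "ball q \<rho>" u] square_integral_ball[OF assms(1)]
    square_integral_ball[OF assms(2)] \<omega>_pos
    emeasure_lborel_ball_finite[of p \<rho>] emeasure_lborel_ball_finite[of q \<rho>]
  by (simp add: measure_ball_\<rho> m_def power2_eq_square[of \<omega>])

section \<open>The energy estimate along chains\<close>

lemma ball_in_S: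
  assumes "x \<in> A" "ball p \<rho> \<subseteq> F" "dist x p \<le> M + R"
  shows "ball p \<rho> \<subseteq> S"
proof -
  have "ball p \<rho> \<subseteq> ball x (M + R + \<rho>)"
  proof
    fix y assume "y \<in> ball p \<rho>"
    then show "y \<in> ball x (M + R + \<rho>)" using assms(3) dist_triangle[of x y p] by simp
  qed
  then show ?thesis using deep[OF assms(1)] assms(2) by blast
qed

text \<open>One function that dominates every link of a chain starting near \<open>x\<close>: the
  centres stay within M + R of \<open>x\<close>, and the points of their balls within \<rho>
  more.\<close>

definition "G x = (\<integral>\<^sup>+z. local_energy S r\<^sub>0 u z * indicator (cball 0 (M + R + \<rho>)) (x - z) \<partial>lborel)"

lemma G_borel [measurable]: "G \<in> borel_measurable borel"
  unfolding G_def[abs_def] by measurable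

text \<open>Points of the two balls are at most dist p q + 2\<rho> apart, so every pair that enters
  the difference of the means is counted in a local energy at range
  \<open>r\<^sub>0\<close>.\<close>

lemma mean_step:
  assumes x: "x \<in> A"
    and p: "ball p \<rho> \<subseteq> F" "dist x p \<le> M + R" and q: "ball q \<rho> \<subseteq> F" "dist x q \<le> M + R"
    and pq: "dist p q + 2 * \<rho> \<le> r\<^sub>0"
  shows "ennreal (\<omega>\<^sup>2 * (m p - m q)\<^sup>2) \<le> G x"
proof -
  note S = ball_in_S[OF x p] ball_in_S[OF x q]
  have "ennreal (\<omega>\<^sup>2 * (m p - m q)\<^sup>2)
      \<le> (\<integral>\<^sup>+z\<in>ball p \<rho>. (\<integral>\<^sup>+w\<in>ball q \<rho>. ennreal ((u w - u z)\<^sup>2) \<partial>lborel) \<partial>lborel)"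
    by (rule mean_difference[OF S])
  also have "\<dots> \<le> G x"
    unfolding G_def
  proof (rule nn_integral_mono)
    fix z
    show "(\<integral>\<^sup>+w\<in>ball q \<rho>. ennreal ((u w - u z)\<^sup>2) \<partial>lborel) * indicator (ball p \<rho>) z
        \<le> local_energy S r\<^sub>0 u z * indicator (cball 0 (M + R + \<rho>)) (x - z)"
    proof (cases "z \<in> ball p \<rho>")
      case True
      have "x - z \<in> cball 0 (M + R + \<rho>)"
        using True p(2) dist_triangle[of x z p] unfolding diff_mem_cball by simp
      moreover have "(\<integral>\<^sup>+w\<in>ball q \<rho>. ennreal ((u w - u z)\<^sup>2) \<partial>lborel) \<le> local_energy S r\<^sub>0 u z"
        unfolding local_energy_def
      proof (rule nn_integral_mono)
        fix w
        have "z - w \<in> cball 0 r\<^sub>0" if "w \<in> ball q \<rho>"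
        proof -
          have "dist z w \<le> dist z p + dist p q + dist q w"
            using dist_triangle[of z w p] dist_triangle[of p w q] by linarith
          then show ?thesis using that True pq unfolding diff_mem_cball by (simp add: dist_commute)
        qed
        then show "ennreal ((u w - u z)\<^sup>2) * indicator (ball q \<rho>) w
            \<le> ennreal ((u w - u z)\<^sup>2) * (indicator S z * indicator S w * indicator (cball 0 r\<^sub>0) (z - w))"
          using True S by (cases "w \<in> ball q \<rho>") (auto simp: indicator_def)
      qed
      ultimately show ?thesis using True by simp
    qed simp
  qed
  finally show ?thesis .
qed

text \<open>Telescoping and the Cauchy-Schwarz inequality cost one factor n; bounding each of the n
  links by the same \<open>G x\<close> costs the other.\<close>

lemma mean_chain:
  assumes x: "x \<in> A" and p: "ball p \<rho> \<subseteq> F" "dist x p \<le> M" and q: "ball q \<rho> \<subseteq> F"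
    and pq: "dist p q \<le> r + 2 * M"
  shows "ennreal (\<omega>\<^sup>2 * (m p - m q)\<^sup>2) \<le> ennreal ((real N)\<^sup>2) * G x"
proof -
  obtain n f where f: "n \<le> N" "f 0 = p" "f n = q"
    "\<And>i. i \<le> n \<Longrightarrow> ball (f i) \<rho> \<subseteq> F" "\<And>i. i \<le> n \<Longrightarrow> dist p (f i) \<le> R"
    "\<And>i. i < n \<Longrightarrow> dist (f i) (f (Suc i)) + 2 * \<rho> \<le> r\<^sub>0"
    using chain[OF p(1) q pq] by blast
  have near_x: "dist x (f i) \<le> M + R" if "i \<le> n" for i
    using f(5)[OF that] p(2) dist_triangle[of x "f i" p] by linarith
  have "m p - m q = (\<Sum>i<n. m (f i) - m (f (Suc i)))"
    using sum_lessThan_telescope'[of "\<lambda>i. m (f i)" n] f(2,3) by simp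
  then have "(m p - m q)\<^sup>2 \<le> real n * (\<Sum>i<n. (m (f i) - m (f (Suc i)))\<^sup>2)"
    using sum_squared_le_sum_of_squares[of "\<lambda>i. m (f i) - m (f (Suc i))" "{..<n}"]
    by (simp add: mult.commute)
  then have "\<omega>\<^sup>2 * (m p - m q)\<^sup>2 \<le> \<omega>\<^sup>2 * (real n * (\<Sum>i<n. (m (f i) - m (f (Suc i)))\<^sup>2))"
    by (rule mult_left_mono) simp
  also have "\<dots> = real n * (\<Sum>i<n. \<omega>\<^sup>2 * (m (f i) - m (f (Suc i)))\<^sup>2)"
    by (simp add: sum_distrib_left[symmetric] mult.left_commute)
  finally have "ennreal (\<omega>\<^sup>2 * (m p - m q)\<^sup>2)
      \<le> ennreal (real n * (\<Sum>i<n. \<omega>\<^sup>2 * (m (f i) - m (f (Suc i)))\<^sup>2))"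
    by (rule ennreal_leI)
  also have "\<dots> = ennreal (real n) * (\<Sum>i<n. ennreal (\<omega>\<^sup>2 * (m (f i) - m (f (Suc i)))\<^sup>2))"
    by (subst sum_ennreal) (simp_all add: ennreal_mult' sum_nonneg)
  also have "\<dots> \<le> ennreal (real n) * (\<Sum>i<n. G x)"
    using x f near_x by (intro mult_left_mono sum_mono mean_step) auto
  also have "\<dots> = ennreal ((real n)\<^sup>2) * G x"
    by (simp add: power2_eq_square ennreal_mult' mult.assoc ennreal_of_nat_eq_real_of_nat)
  also have "\<dots> \<le> ennreal ((real N)\<^sup>2) * G x"
    using f(1) by (intro mult_right_mono ennreal_leI power_mono) auto
  finally show ?thesis .
qed

text \<open>This treats both kinds of points alike. In a hole \<open>v x\<close> is itself a mean
  and the deviation is 0; in \<open>F\<close> there is a ball within range of \<open>x\<close>, and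
  the deviation is controlled by the energy at \<open>x\<close>.\<close>

lemma centre_exists:
  assumes x: "x \<in> A"
  shows "\<exists>p. ball p \<rho> \<subseteq> F \<and> dist x p \<le> M \<and> ennreal (\<omega> * (m p - v x)\<^sup>2) \<le> local_energy S r\<^sub>0 u x"
proof (cases "x \<in> F")
  case False
  then show ?thesis using x P_ball P_dist by (intro exI[of _ "P x"]) (simp add: v_def)
next
  case True
  obtain p where p: "ball p \<rho> \<subseteq> F" "dist x p + \<rho> \<le> r\<^sub>0" "dist x p \<le> M" using near[OF True] by blast
  have pS: "ball p \<rho> \<subseteq> S" using ball_in_S[OF x p(1)] p(3) R_nonneg by simp
  have "x \<in> \<Omega>"
    using deep[OF x] R_nonneg M_nonneg \<rho>_pos centre_in_ball[of x "M + R + \<rho>"] by (simp add: subset_iff)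
  then have xS: "x \<in> S" using True by simp
  have "ennreal (\<omega> * (m p - v x)\<^sup>2) \<le> (\<integral>\<^sup>+y\<in>ball p \<rho>. ennreal ((u y - u x)\<^sup>2) \<partial>lborel)"
    using mean_deviation[OF pS, of "u x"] xS by (simp add: v_def)
  also have "\<dots> \<le> local_energy S r\<^sub>0 u x"
    unfolding local_energy_def
  proof (rule nn_integral_mono)
    fix y
    have "x - y \<in> cball 0 r\<^sub>0" if "y \<in> ball p \<rho>"
      using that p(2) dist_triangle[of x y p] unfolding diff_mem_cball by simp
    then show "ennreal ((u y - u x)\<^sup>2) * indicator (ball p \<rho>) y
        \<le> ennreal ((u y - u x)\<^sup>2) * (indicator S x * indicator S y * indicator (cball 0 r\<^sub>0) (x - y))"
      using xS pS by (cases "y \<in> ball p \<rho>") (auto simp: indicator_def)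
  qed
  finally show ?thesis using p by blast
qed

text \<open>The difference passes through the means over balls near \<open>x\<close> and near
  \<open>y\<close>, whose centres are at most r + 2M apart. The 3 comes from squaring a sum of three
  terms, and the divisions by \<omega> and \<omega>^2 undo the volumes in the estimates for a value
  against a mean and for two means.\<close>

lemma pointwise_bound:
  assumes x: "x \<in> A" and y: "y \<in> A" and xy: "dist x y \<le> r"
  shows "ennreal ((v y - v x)\<^sup>2) \<le> ennreal (3 / \<omega>) * (local_energy S r\<^sub>0 u x + local_energy S r\<^sub>0 u y)
    + ennreal (3 * (real N)\<^sup>2 / \<omega>\<^sup>2) * G x"
proof -
  obtain p where p: "ball p \<rho> \<subseteq> F" "dist x p \<le> M" "ennreal (\<omega> * (m p - v x)\<^sup>2) \<le> local_energy S r\<^sub>0 u x"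
    using centre_exists[OF x] by blast
  obtain q where q: "ball q \<rho> \<subseteq> F" "dist y q \<le> M" "ennreal (\<omega> * (m q - v y)\<^sup>2) \<le> local_energy S r\<^sub>0 u y"
    using centre_exists[OF y] by blast
  have "dist p q \<le> r + 2 * M"
    using p(2) q(2) xy dist_triangle[of p q x] dist_triangle[of x q y] dist_commute[of p x] by linarith
  then have pq: "ennreal (\<omega>\<^sup>2 * (m p - m q)\<^sup>2) \<le> ennreal ((real N)\<^sup>2) * G x"
    using mean_chain[OF x p(1,2) q(1)] by simp
  have "(a + b + c)\<^sup>2 \<le> 3 * a\<^sup>2 + 3 * b\<^sup>2 + 3 * c\<^sup>2" for a b c :: real
    using zero_le_power2[of "a - b"] zero_le_power2[of "b - c"] zero_le_power2[of "a - c"]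
    by (simp add: power2_eq_square algebra_simps)
  from this[of "m p - v x" "v y - m q" "m q - m p"]
  have "(v y - v x)\<^sup>2 \<le> 3 * (m p - v x)\<^sup>2 + 3 * (m q - v y)\<^sup>2 + 3 * (m p - m q)\<^sup>2"
    by (simp add: power2_commute)
  also have "\<dots> = 3 / \<omega> * (\<omega> * (m p - v x)\<^sup>2 + \<omega> * (m q - v y)\<^sup>2) + 3 / \<omega>\<^sup>2 * (\<omega>\<^sup>2 * (m p - m q)\<^sup>2)"
    using \<omega>_pos by (simp add: field_simps)
  finally have "ennreal ((v y - v x)\<^sup>2) \<le> ennreal \<dots>" by (rule ennreal_leI)
  also have "\<dots> = ennreal (3 / \<omega>) * (ennreal (\<omega> * (m p - v x)\<^sup>2) + ennreal (\<omega> * (m q - v y)\<^sup>2))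
      + ennreal (3 / \<omega>\<^sup>2) * ennreal (\<omega>\<^sup>2 * (m p - m q)\<^sup>2)"
    using \<omega>_pos by (simp add: ennreal_mult'[symmetric] ennreal_plus[symmetric] del: ennreal_plus)
  also have "\<dots> \<le> ennreal (3 / \<omega>) * (local_energy S r\<^sub>0 u x + local_energy S r\<^sub>0 u y)
      + ennreal (3 / \<omega>\<^sup>2) * (ennreal ((real N)\<^sup>2) * G x)"
    using p(3) q(3) pq by (intro add_mono mult_left_mono) auto
  also have "ennreal (3 / \<omega>\<^sup>2) * (ennreal ((real N)\<^sup>2) * G x) = ennreal (3 * (real N)\<^sup>2 / \<omega>\<^sup>2) * G x"
    by (simp add: mult.assoc[symmetric] ennreal_mult''[symmetric])
  finally show ?thesis .
qed

text \<open>Integrated over pairs at distance at most \<open>r\<close>, each term of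
  \<open>pointwise_bound\<close> becomes a convolution with a ball and contributes \<open>V\<close>;
  \<open>G\<close>, itself such a convolution, contributes \<open>V'\<close> as well. Since \<omega>
  is a power of \<rho> times \<kappa>, all powers of \<kappa> cancel and only ratios of lengths
  remain.\<close>

lemma energy_bound:
  "pair_energy A r v \<le> ennreal (6 * (r / \<rho>) ^ DIM('a)
      + 3 * (real N)\<^sup>2 * (r / \<rho>) ^ DIM('a) * ((M + R + \<rho>) / \<rho>) ^ DIM('a)) * pair_energy S r\<^sub>0 u"
proof -
  define \<kappa> where "\<kappa> = measure lborel (ball (0::'a) 1)"
  define c1 where "c1 = 3 / \<omega>"
  define c2 where "c2 = 3 * (real N)\<^sup>2 / \<omega>\<^sup>2"
  define V where "V = r ^ DIM('a) * \<kappa>"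
  define V' where "V' = (M + R + \<rho>) ^ DIM('a) * \<kappa>"
  let ?g = "local_energy S r\<^sub>0 u" and ?i = "\<lambda>x y. indicator (cball 0 r) (x - y)"
  have \<kappa>: "\<kappa> > 0" unfolding \<kappa>_def by (rule content_ball_pos) simp
  have pos: "c1 \<ge> 0" "c2 \<ge> 0" "V \<ge> 0" "V' \<ge> 0"
    using \<omega>_pos \<kappa> r_nonneg M_nonneg R_nonneg \<rho>_pos by (simp_all add: c1_def c2_def V_def V'_def)
  have "pair_energy A r v \<le> (\<integral>\<^sup>+x. \<integral>\<^sup>+y. ennreal c1 * (?g x * ?i x y) + ennreal c1 * (?g y * ?i x y)
      + ennreal c2 * (G x * ?i x y) \<partial>lborel \<partial>lborel)"
    unfolding pair_energy_def local_energy_def[of A]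
  proof (intro nn_integral_mono)
    fix x y
    show "ennreal ((v y - v x)\<^sup>2) * (indicator A x * indicator A y * ?i x y)
        \<le> ennreal c1 * (?g x * ?i x y) + ennreal c1 * (?g y * ?i x y) + ennreal c2 * (G x * ?i x y)"
    proof (cases "x \<in> A \<and> y \<in> A \<and> x - y \<in> cball 0 r")
      case True
      then have "dist x y \<le> r" unfolding diff_mem_cball by blast
      then show ?thesis
        using True pointwise_bound[of x y] by (simp add: c1_def c2_def distrib_left)
    qed (auto simp: indicator_def)
  qed
  also have "\<dots> = ennreal c1 * (\<integral>\<^sup>+x. \<integral>\<^sup>+y. ?g x * ?i x y \<partial>lborel \<partial>lborel)
      + ennreal c1 * (\<integral>\<^sup>+x. \<integral>\<^sup>+y. ?g y * ?i x y \<partial>lborel \<partial>lborel)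
      + ennreal c2 * (\<integral>\<^sup>+x. \<integral>\<^sup>+y. G x * ?i x y \<partial>lborel \<partial>lborel)"
    by (simp add: nn_integral_add nn_integral_cmult)
  also have "\<dots> = ennreal c1 * (ennreal V * pair_energy S r\<^sub>0 u) + ennreal c1 * (ennreal V * pair_energy S r\<^sub>0 u)
      + ennreal c2 * (ennreal V * (\<integral>\<^sup>+x. G x \<partial>lborel))"
    by (simp add: nn_integral_convolution_cball r_nonneg V_def \<kappa>_def pair_energy_def)
  also have "(\<integral>\<^sup>+x. G x \<partial>lborel) = ennreal V' * pair_energy S r\<^sub>0 u"
    unfolding G_def using M_nonneg R_nonneg \<rho>_pos
    by (simp add: nn_integral_convolution_cball V'_def \<kappa>_def pair_energy_def)
  also have "ennreal c1 * (ennreal V * pair_energy S r\<^sub>0 u) + ennreal c1 * (ennreal V * pair_energy S r\<^sub>0 u)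
      + ennreal c2 * (ennreal V * (ennreal V' * pair_energy S r\<^sub>0 u))
      = ennreal (2 * c1 * V + c2 * V * V') * pair_energy S r\<^sub>0 u"
  proof -
    have "ennreal (2 * c1 * V + c2 * V * V') = ennreal c1 * ennreal V + ennreal c1 * ennreal V + ennreal c2 * ennreal V * ennreal V'"
      using pos by (simp add: ennreal_mult[symmetric] ennreal_plus[symmetric] del: ennreal_plus)
    then show ?thesis by (simp add: distrib_right mult.assoc)
  qed
  also have "2 * c1 * V + c2 * V * V' = 6 * (r / \<rho>) ^ DIM('a)
      + 3 * (real N)\<^sup>2 * (r / \<rho>) ^ DIM('a) * ((M + R + \<rho>) / \<rho>) ^ DIM('a)"
    using \<kappa> \<rho>_pos by (simp add: c1_def c2_def V_def V'_def \<omega>_def \<kappa>_def[symmetric] power_divide power2_eq_square)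
  finally show ?thesis .
qed

text \<open>In a hole, the case a = 0 of \<open>mean_deviation\<close> bounds the square by an
  average of u^2 over points within M + \<rho>, and Fubini integrates this. Working on all of
  \<Omega> also yields the square integrability of the extension.\<close>

lemma square_bound:
  "(\<integral>\<^sup>+x\<in>\<Omega>. ennreal ((v x)\<^sup>2) \<partial>lborel)
    \<le> ennreal (1 + ((M + \<rho>) / \<rho>) ^ DIM('a)) * (\<integral>\<^sup>+x\<in>S. ennreal ((u x)\<^sup>2) \<partial>lborel)"
proof -
  define \<kappa> where "\<kappa> = measure lborel (ball (0::'a) 1)"
  have \<kappa>: "\<kappa> > 0" unfolding \<kappa>_def by (rule content_ball_pos) simp
  define h where "h y = ennreal ((u y)\<^sup>2) * indicator S y" for y
  have [measurable]: "h \<in> borel_measurable borel" unfolding h_def[abs_def] by measurable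
  have "(\<integral>\<^sup>+x\<in>\<Omega>. ennreal ((v x)\<^sup>2) \<partial>lborel)
      \<le> (\<integral>\<^sup>+x. h x + ennreal (1 / \<omega>) * (\<integral>\<^sup>+y. h y * indicator (cball 0 (M + \<rho>)) (x - y) \<partial>lborel) \<partial>lborel)"
  proof (rule nn_integral_mono)
    fix x
    consider "x \<in> S" | "x \<notin> S" "x \<in> A" | "x \<notin> S" "x \<notin> A" by blast
    then show "ennreal ((v x)\<^sup>2) * indicator \<Omega> x
        \<le> h x + ennreal (1 / \<omega>) * (\<integral>\<^sup>+y. h y * indicator (cball 0 (M + \<rho>)) (x - y) \<partial>lborel)"
    proof cases
      case 1
      then show ?thesis by (simp add: v_def h_def)
    next
      case 2
      have PS: "ball (P x) \<rho> \<subseteq> S" using ball_in_S[OF 2(2) P_ball] P_dist[of x] R_nonneg by simp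
      have "ennreal (\<omega> * (m (P x))\<^sup>2) \<le> (\<integral>\<^sup>+y\<in>ball (P x) \<rho>. ennreal ((u y)\<^sup>2) \<partial>lborel)"
        using mean_deviation[OF PS, of 0] by simp
      also have "\<dots> \<le> (\<integral>\<^sup>+y. h y * indicator (cball 0 (M + \<rho>)) (x - y) \<partial>lborel)"
      proof (rule nn_integral_mono)
        fix y
        have "x - y \<in> cball 0 (M + \<rho>)" if "y \<in> ball (P x) \<rho>"
          using that P_dist[of x] dist_triangle[of x y "P x"] unfolding diff_mem_cball by simp
        then show "ennreal ((u y)\<^sup>2) * indicator (ball (P x) \<rho>) y \<le> h y * indicator (cball 0 (M + \<rho>)) (x - y)"
          using PS by (cases "y \<in> ball (P x) \<rho>") (auto simp: indicator_def h_def)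
      qed
      finally have "ennreal (1 / \<omega>) * ennreal (\<omega> * (m (P x))\<^sup>2)
          \<le> ennreal (1 / \<omega>) * (\<integral>\<^sup>+y. h y * indicator (cball 0 (M + \<rho>)) (x - y) \<partial>lborel)"
        by (rule mult_left_mono) simp
      moreover have "v x = m (P x)" using 2 by (auto simp: v_def)
      then have "ennreal (1 / \<omega>) * ennreal (\<omega> * (m (P x))\<^sup>2) = ennreal ((v x)\<^sup>2)"
        using \<omega>_pos by (simp add: ennreal_mult'[symmetric])
      ultimately show ?thesis
        by (auto simp: indicator_def intro: add_increasing)
    next
      case 3
      then have "v x = 0" by (auto simp: v_def)
      then show ?thesis by simp
    qed
  qed
  also have "\<dots> = (\<integral>\<^sup>+x. h x \<partial>lborel)
      + ennreal (1 / \<omega>) * (ennreal ((M + \<rho>) ^ DIM('a) * \<kappa>) * (\<integral>\<^sup>+x. h x \<partial>lborel))"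
    using M_nonneg \<rho>_pos by (simp add: nn_integral_add nn_integral_cmult nn_integral_convolution_cball \<kappa>_def)
  also have "\<dots> = (1 + ennreal (1 / \<omega>) * ennreal ((M + \<rho>) ^ DIM('a) * \<kappa>)) * (\<integral>\<^sup>+x. h x \<partial>lborel)"
    by (simp add: distrib_right mult.assoc)
  also have "ennreal (1 / \<omega>) * ennreal ((M + \<rho>) ^ DIM('a) * \<kappa>) = ennreal (1 / \<omega> * ((M + \<rho>) ^ DIM('a) * \<kappa>))"
    using \<omega>_pos by (intro ennreal_mult'[symmetric]) simp
  also have "1 / \<omega> * ((M + \<rho>) ^ DIM('a) * \<kappa>) = ((M + \<rho>) / \<rho>) ^ DIM('a)"
    using \<kappa> \<rho>_pos by (simp add: \<omega>_def \<kappa>_def[symmetric] power_divide)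
  also have "1 + ennreal (((M + \<rho>) / \<rho>) ^ DIM('a)) = ennreal (1 + ((M + \<rho>) / \<rho>) ^ DIM('a))"
    using M_nonneg \<rho>_pos by simp
  finally show ?thesis by (simp add: h_def)
qed

end

section \<open>Extension with constants independent of the scale\<close>

text \<open>A null set \<open>N\<close> of exceptional points affects only the pairs with a
  coordinate in \<open>N\<close>, again a null set. This allows passing from a Lebesgue
  representative to a Borel one, and so to iterated integrals.\<close>

lemma nonlocal_energy_eq_pair_energy:
  fixes w w' :: "'a::euclidean_space \<Rightarrow> real"
  assumes [measurable]: "A \<in> sets borel" "w' \<in> borel_measurable borel"
    and eq: "AE x in lborel. x \<in> A \<longrightarrow> w x = w' x" and \<epsilon>: "\<epsilon> > 0"
  shows "nonlocal_energy A \<epsilon> r w = ennreal (1 / \<epsilon>\<^sup>2) * pair_energy A (\<epsilon> * r) w'"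
proof -
  let ?f = "\<lambda>w x y. ennreal (((w y - w x) / \<epsilon>)\<^sup>2) *
      (indicator A x * indicator A y * indicator (cball 0 (\<epsilon> * r)) (x - y))"
  have [measurable]: "A \<in> sets lborel" "w' \<in> borel_measurable lborel" by simp_all
  obtain N where N: "{x. \<not> (x \<in> A \<longrightarrow> w x = w' x)} \<subseteq> N" "N \<in> null_sets lborel"
    using eq by (auto elim!: AE_E simp: null_sets_def)
  have "N \<times> UNIV \<in> null_sets (lborel \<Otimes>\<^sub>M lborel)" "UNIV \<times> N \<in> null_sets (lborel \<Otimes>\<^sub>M lborel)"
    using N(2) by (auto intro: lborel.times_in_null_sets1 lborel.times_in_null_sets2)
  then have null: "N \<times> UNIV \<union> UNIV \<times> N \<in> null_sets (lborel :: ('a \<times> 'a) measure)"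
    unfolding lborel_prod by (rule null_sets.Un)
  \<comment> \<open>The nonnegative integral over a completion equals that over the original measure
    for every function, so no measurability of \<open>w\<close> enters here.\<close>
  have "nonlocal_energy A \<epsilon> r w = (\<integral>\<^sup>+z. ?f w (fst z) (snd z) \<partial>lborel)"
    unfolding nonlocal_energy_def nn_integral_completion
    by (intro nn_integral_cong) (auto simp: indicator_def diff_mem_cball dist_norm simp del: mem_cball)
  also have "\<dots> = (\<integral>\<^sup>+z. ?f w' (fst z) (snd z) \<partial>lborel)"
  proof (rule nn_integral_cong_AE, rule AE_I'[OF null])
    show "{z \<in> space lborel. ?f w (fst z) (snd z) \<noteq> ?f w' (fst z) (snd z)} \<subseteq> N \<times> UNIV \<union> UNIV \<times> N"
    proof
      fix z assume "z \<in> {z \<in> space lborel. ?f w (fst z) (snd z) \<noteq> ?f w' (fst z) (snd z)}"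
      then have ne: "?f w (fst z) (snd z) \<noteq> ?f w' (fst z) (snd z)" by simp
      show "z \<in> N \<times> UNIV \<union> UNIV \<times> N"
      proof (rule ccontr)
        assume "z \<notin> N \<times> UNIV \<union> UNIV \<times> N"
        then have "fst z \<notin> N" "snd z \<notin> N" by (auto simp: mem_Times_iff)
        then have "fst z \<in> A \<longrightarrow> w (fst z) = w' (fst z)" "snd z \<in> A \<longrightarrow> w (snd z) = w' (snd z)"
          using N(1) by blast+
        then show False using ne by (cases "fst z \<in> A \<and> snd z \<in> A") auto
      qed
    qed
  qed
  also have "\<dots> = (\<integral>\<^sup>+z. ?f w' (fst z) (snd z) \<partial>(lborel \<Otimes>\<^sub>M lborel))"
    by (simp only: lborel_prod)
  also have "\<dots> = (\<integral>\<^sup>+x. \<integral>\<^sup>+y. ?f w' x y \<partial>lborel \<partial>lborel)"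
    by (subst lborel.nn_integral_fst[symmetric]) simp_all
  also have "\<dots> = (\<integral>\<^sup>+x. \<integral>\<^sup>+y. ennreal (1 / \<epsilon>\<^sup>2) * (ennreal ((w' y - w' x)\<^sup>2) *
      (indicator A x * indicator A y * indicator (cball 0 (\<epsilon> * r)) (x - y))) \<partial>lborel \<partial>lborel)"
  proof -
    have "ennreal (((w' y - w' x) / \<epsilon>)\<^sup>2) = ennreal (1 / \<epsilon>\<^sup>2) * ennreal ((w' y - w' x)\<^sup>2)" for x y
      by (simp add: ennreal_mult'[symmetric] power_divide)
    then show ?thesis by (simp add: mult.assoc)
  qed
  also have "\<dots> = ennreal (1 / \<epsilon>\<^sup>2) * pair_energy A (\<epsilon> * r) w'"
    unfolding pair_energy_def local_energy_def by (simp add: nn_integral_cmult)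
  finally show ?thesis .
qed

section \<open>Inner parts and dilations\<close>

lemma open_inner_part: "open \<Omega> \<Longrightarrow> open (inner_part \<Omega> t)"
proof -
  assume "open \<Omega>"
  moreover have "open {x. infdist x (frontier \<Omega>) > t}"
    by (intro open_Collect_less continuous_intros)
  moreover have "inner_part \<Omega> t = (if frontier \<Omega> = {} then \<Omega> else \<Omega> \<inter> {x. infdist x (frontier \<Omega>) > t})"
    by (auto simp: inner_part_def)
  ultimately show ?thesis by auto
qed

text \<open>A ball is connected, so if it is centred in \<Omega> and leaves it, it meets the
  frontier, which is too far away. For t \<le> 0 the ball is empty.\<close>

lemma inner_part_ball_subset:
  fixes \<Omega> :: "'a::euclidean_space set"
  assumes "x \<in> inner_part \<Omega> t"
  shows "ball x t \<subseteq> \<Omega>"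
proof (rule ccontr)
  assume not_sub: "\<not> ball x t \<subseteq> \<Omega>"
  then have "ball x t \<noteq> {}" by blast
  then have "x \<in> ball x t" by simp
  then have "ball x t \<inter> frontier \<Omega> \<noteq> {}"
    using assms not_sub unfolding inner_part_def by (intro connected_Int_frontier connected_ball) blast+
  then obtain z where "z \<in> frontier \<Omega>" "dist x z < t" by auto
  moreover have "infdist x (frontier \<Omega>) \<le> dist x z" using \<open>z \<in> frontier \<Omega>\<close> by (rule infdist_le)
  ultimately show False using assms by (auto simp: inner_part_def)
qed

lemma scaled_ball_subset_iff:
  fixes p :: "'a::real_normed_vector"
  assumes "\<epsilon> > 0"
  shows "ball (\<epsilon> *\<^sub>R p) (\<epsilon> * \<rho>) \<subseteq> (*\<^sub>R) \<epsilon> ` E \<longleftrightarrow> ball p \<rho> \<subseteq> E"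
proof -
  have "ball (\<epsilon> *\<^sub>R p) (\<epsilon> * \<rho>) = (*\<^sub>R) \<epsilon> ` ball p \<rho>"
    using ball_scale[of \<epsilon> p \<rho>] assms by simp
  moreover have "inj ((*\<^sub>R) \<epsilon> :: 'a \<Rightarrow> 'a)" using assms by (auto intro: injI)
  ultimately show ?thesis by (simp add: inj_image_subset_iff)
qed

theorem theorem3p2:
  fixes E \<Omega> :: "'a::euclidean_space set" and \<K> :: "'a set set"
  assumes "open E" and "connected E"
    and "- E = \<Union>\<K>" and "\<forall>K\<in>\<K>. bounded K \<and> closed K"
    and "\<exists>D. \<forall>K\<in>\<K>. diameter K \<le> D"
    and "\<exists>\<delta>>0. \<forall>K\<in>\<K>. \<forall>K'\<in>\<K>. K \<noteq> K' \<longrightarrow> (\<forall>x\<in>K. \<forall>y\<in>K'. dist x y \<ge> \<delta>)"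
    and "uniformly_lipschitz_boundary E"
    and "open \<Omega>" and "lipschitz_boundary \<Omega>"
  shows "\<forall>r\<^sub>0>0. \<exists>k>0. \<exists>r>0. \<exists>C>0. \<forall>\<epsilon>>0. \<forall>u.
    u square_integrable_on (\<Omega> \<inter> (*\<^sub>R) \<epsilon> ` E) \<longrightarrow>
    (\<exists>v. v square_integrable_on \<Omega> \<and>
       (\<forall>x\<in>\<Omega> \<inter> (*\<^sub>R) \<epsilon> ` E. v x = u x) \<and>
       nonlocal_energy (inner_part \<Omega> (k * \<epsilon>)) \<epsilon> r v
         \<le> ennreal C * nonlocal_energy (\<Omega> \<inter> (*\<^sub>R) \<epsilon> ` E) \<epsilon> r\<^sub>0 u \<and>
       (\<integral>\<^sup>+x\<in>inner_part \<Omega> (k * \<epsilon>). ennreal ((v x)\<^sup>2) \<partial>lebesgue)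
         \<le> ennreal C * (\<integral>\<^sup>+x\<in>\<Omega> \<inter> (*\<^sub>R) \<epsilon> ` E. ennreal ((u x)\<^sup>2) \<partial>lebesgue))"
proof (intro allI impI)
  fix r\<^sub>0 :: real assume r0: "r\<^sub>0 > 0"
  \<comment> \<open>A link of length at most 4s and two radii \<rho> \<le> s have to fit into the
    range: 6s = \<open>r\<^sub>0\<close>.\<close>
  define s where "s = r\<^sub>0 / 6"
  have s: "s > 0" using r0 by (simp add: s_def)
  obtain \<rho> where \<rho>: "\<rho> > 0" "\<rho> \<le> s" and near: "\<And>x. x \<in> E \<Longrightarrow> \<exists>p. ball p \<rho> \<subseteq> E \<and> dist x p \<le> s"
    using lipschitz_interior_balls[OF assms(7) s] by blast
  obtain D' where D': "\<And>K. K \<in> \<K> \<Longrightarrow> diameter K \<le> D'" using assms(5) by blast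
  obtain \<delta> where \<delta>: "\<delta> > 0"
    and sep: "\<forall>K\<in>\<K>. \<forall>K'\<in>\<K>. K \<noteq> K' \<longrightarrow> (\<forall>x\<in>K. \<forall>y\<in>K'. dist x y \<ge> \<delta>)"
    using assms(6) by (elim exE conjE)
  \<comment> \<open>If there are no holes, \<open>D'\<close> is arbitrary and may be
    negative.\<close>
  define D where "D = max D' 0"
  interpret separated_holes E \<K> D \<delta>
  proof
    show "compact K" if "K \<in> \<K>" for K using assms(4) that compact_eq_bounded_closed by blast
    show "dist x y \<le> D" if "K \<in> \<K>" "x \<in> K" "y \<in> K" for K x y
      using diameter_bounded_bound[of K x y] assms(4) that D'[OF that(1)] by (auto simp: D_def)
    show "D \<ge> 0" by (simp add: D_def)
    show "dist x y \<ge> \<delta>" if "K \<in> \<K>" "K' \<in> \<K>" "K \<noteq> K'" "x \<in> K" "y \<in> K'" for K K' x y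
      using sep that by blast
  qed (fact assms \<delta>)+
  have "\<exists>p. ball p \<rho> \<subseteq> E \<and> dist x p \<le> D + 1 + \<delta> + s" for x
  proof -
    obtain y where y: "y \<in> E" "dist x y \<le> D + 1 + \<delta>" using near_E by blast
    obtain p where p: "ball p \<rho> \<subseteq> E" "dist y p \<le> s" using near[OF y(1)] by blast
    then show ?thesis using y dist_triangle[of x p y] by (intro exI[of _ p]) auto
  qed
  from measurable_ball_centres[OF this] obtain P where
    P_borel: "P \<in> borel_measurable borel" and P: "\<And>x. ball (P x) \<rho> \<subseteq> E"
      "\<And>x. dist x (P x) \<le> D + 1 + \<delta> + s + DIM('a)"
    by blast
  \<comment> \<open>A point of \<open>E\<close> lies within D + 1 + \<delta>, a centre within a
    further s, and rounding adds the dimension. \<open>R\<close> is the excursion of chains between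
    centres less than 1 + 2M + 1 apart: the range r = 1 is enlarged by M at both ends, and the last
    1 makes a weak inequality strict.\<close>
  define M where "M = D + 1 + \<delta> + s + DIM('a)"
  define R where "R = 1 + 2 * M + 1 + D + \<delta> + s"
  have M: "M > 0" "s \<le> M" using s \<delta> D_nonneg by (simp_all add: M_def)
  have R: "R > 0" using s \<delta> D_nonneg M by (simp add: R_def)
  obtain N :: nat where N: "\<forall>p q. ball p \<rho> \<subseteq> E \<longrightarrow> ball q \<rho> \<subseteq> E \<longrightarrow> dist p q < 1 + 2 * M + 1 \<longrightarrow>
    (\<exists>n\<le>N. \<exists>f. f 0 = p \<and> f n = q \<and>
      (\<forall>i\<le>n. ball (f i) \<rho> \<subseteq> E \<and> dist p (f i) \<le> R) \<and>
      (\<forall>i<n. dist (f i) (f (Suc i)) \<le> 4 * s))"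
    using bounded_ball_chains[OF near \<rho>(1) s, of "1 + 2 * M + 1"] M(1) unfolding R_def by auto
  \<comment> \<open>At most M leads from \<open>x\<close> to the first centre, R along the chain and
    \<rho> across a ball; at this depth all balls in use stay in \<Omega>.\<close>
  define k where "k = M + R + \<rho>"
  define C1 where "C1 = 6 * (1 / \<rho>) ^ DIM('a)
      + 3 * (real N)\<^sup>2 * (1 / \<rho>) ^ DIM('a) * ((M + R + \<rho>) / \<rho>) ^ DIM('a)"
  define C2 where "C2 = 1 + ((M + \<rho>) / \<rho>) ^ DIM('a)"
  have k: "k > 0" using M R \<rho> by (simp add: k_def)
  have C: "C1 \<ge> 0" "C2 > 0" using M R \<rho> by (simp_all add: C1_def C2_def add_pos_nonneg)
  have "\<exists>v. v square_integrable_on \<Omega> \<and>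
       (\<forall>x\<in>\<Omega> \<inter> (*\<^sub>R) \<epsilon> ` E. v x = u x) \<and>
       nonlocal_energy (inner_part \<Omega> (k * \<epsilon>)) \<epsilon> 1 v
         \<le> ennreal (C1 + C2) * nonlocal_energy (\<Omega> \<inter> (*\<^sub>R) \<epsilon> ` E) \<epsilon> r\<^sub>0 u \<and>
       (\<integral>\<^sup>+x\<in>inner_part \<Omega> (k * \<epsilon>). ennreal ((v x)\<^sup>2) \<partial>lebesgue)
         \<le> ennreal (C1 + C2) * (\<integral>\<^sup>+x\<in>\<Omega> \<inter> (*\<^sub>R) \<epsilon> ` E. ennreal ((u x)\<^sup>2) \<partial>lebesgue)"
    if \<epsilon>: "\<epsilon> > 0" and u: "u square_integrable_on (\<Omega> \<inter> (*\<^sub>R) \<epsilon> ` E)" for \<epsilon> u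
  proof -
    define F where "F = (*\<^sub>R) \<epsilon> ` E"
    define A where "A = inner_part \<Omega> (k * \<epsilon>)"
    have "open F" unfolding F_def using \<epsilon> assms(1) by (intro open_scaling) auto
    then have S_open: "open (\<Omega> \<inter> F)" using assms(8) by auto
    then have S_borel [measurable]: "\<Omega> \<inter> F \<in> sets borel" by auto
    have S_leb [measurable]: "\<Omega> \<inter> F \<in> sets lebesgue" using S_open by auto
    \<comment> \<open>\<open>u\<close> is measurable only on \<open>\<Omega> \<inter> F\<close>;
      cutting it off makes it Lebesgue measurable everywhere, so that a Borel representative
      \<open>u'\<close> exists.\<close>
    have "(\<lambda>x. indicator (\<Omega> \<inter> F) x * u x) \<in> borel_measurable lebesgue"
      using u S_leb by (simp add: square_integrable_on_def F_def[symmetric] borel_measurable_restrict_space_iff)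
    note u_meas [measurable] = this
    obtain u' where u' [measurable]: "u' \<in> borel_measurable borel"
      and "AE x in lborel. indicator (\<Omega> \<inter> F) x * u x = u' x"
      using completion_ex_borel_measurable_real[OF u_meas] by auto
    then have u_eq: "AE x in lborel. x \<in> \<Omega> \<inter> F \<longrightarrow> u x = u' x"
      by (auto elim!: eventually_mono)
    have u_int: "(\<integral>\<^sup>+x\<in>\<Omega> \<inter> F. ennreal ((u x)\<^sup>2) \<partial>lebesgue) < \<infinity>"
      using u S_leb by (simp add: square_integrable_on_def F_def[symmetric] integrable_iff_bounded nn_integral_restrict_space)
    have u_sq: "(\<integral>\<^sup>+x\<in>\<Omega> \<inter> F. ennreal ((u x)\<^sup>2) \<partial>lebesgue) = (\<integral>\<^sup>+x\<in>\<Omega> \<inter> F. ennreal ((u' x)\<^sup>2) \<partial>lborel)"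
      unfolding nn_integral_completion
      using u_eq by (intro nn_integral_cong_AE) (auto elim!: eventually_mono simp: indicator_def)
    have F_ball: "ball p (\<epsilon> * \<rho>) \<subseteq> F \<longleftrightarrow> ball (p /\<^sub>R \<epsilon>) \<rho> \<subseteq> E" for p
      using scaled_ball_subset_iff[OF \<epsilon>, of "p /\<^sub>R \<epsilon>" \<rho> E] \<epsilon> by (simp add: F_def)
    have F_ball': "ball (\<epsilon> *\<^sub>R p) (\<epsilon> * \<rho>) \<subseteq> F \<longleftrightarrow> ball p \<rho> \<subseteq> E" for p
      using scaled_ball_subset_iff[OF \<epsilon>, of p \<rho> E] by (simp add: F_def)
    have dist_scale: "dist (\<epsilon> *\<^sub>R p) (\<epsilon> *\<^sub>R q) = \<epsilon> * dist p q" for p q :: 'a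
      using \<epsilon> by (simp add: dist_norm scaleR_diff_right[symmetric])
    \<comment> \<open>All lengths carry the factor \<epsilon>, the number \<open>N\<close> of links
      does not. Writing the new range as \<open>\<epsilon> * 1\<close> lets \<open>scale\<close>
      cancel \<epsilon> from the constants.\<close>
    interpret hole_filling F \<Omega> A "\<epsilon> * \<rho>" "\<epsilon> * M" "\<epsilon> * R" "\<epsilon> * r\<^sub>0" "\<epsilon> * 1" N "\<lambda>x. \<epsilon> *\<^sub>R P (x /\<^sub>R \<epsilon>)" u'
    proof
      show "open A" unfolding A_def by (rule open_inner_part[OF assms(8)])
      show "(\<integral>\<^sup>+x\<in>\<Omega> \<inter> F. ennreal ((u' x)\<^sup>2) \<partial>lborel) < \<infinity>" using u_int u_sq by simp
      show "\<exists>p. ball p (\<epsilon> * \<rho>) \<subseteq> F \<and> dist x p + \<epsilon> * \<rho> \<le> \<epsilon> * r\<^sub>0 \<and> dist x p \<le> \<epsilon> * M" if x: "x \<in> F" for x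
      proof -
        obtain y where y: "y \<in> E" "x = \<epsilon> *\<^sub>R y" using x by (auto simp: F_def)
        obtain p where p: "ball p \<rho> \<subseteq> E" "dist y p \<le> s" using near[OF y(1)] by blast
        have "dist y p + \<rho> \<le> r\<^sub>0" "dist y p \<le> M" using p(2) \<rho>(2) M(2) r0 by (auto simp: s_def)
        then have "\<epsilon> * (dist y p + \<rho>) \<le> \<epsilon> * r\<^sub>0" "\<epsilon> * dist y p \<le> \<epsilon> * M" using \<epsilon> by simp_all
        then show ?thesis using p(1) y(2) F_ball'[of p]
          by (intro exI[of _ "\<epsilon> *\<^sub>R p"]) (simp add: dist_scale distrib_left)
      qed
      show "(\<lambda>x. \<epsilon> *\<^sub>R P (x /\<^sub>R \<epsilon>)) \<in> borel_measurable borel" using P_borel by measurable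
      show "ball (\<epsilon> *\<^sub>R P (x /\<^sub>R \<epsilon>)) (\<epsilon> * \<rho>) \<subseteq> F" for x using P(1) F_ball' by simp
      show "dist x (\<epsilon> *\<^sub>R P (x /\<^sub>R \<epsilon>)) \<le> \<epsilon> * M" for x
      proof -
        have "dist (\<epsilon> *\<^sub>R (x /\<^sub>R \<epsilon>)) (\<epsilon> *\<^sub>R P (x /\<^sub>R \<epsilon>)) \<le> \<epsilon> * M"
          unfolding dist_scale using P(2)[of "x /\<^sub>R \<epsilon>"] \<epsilon> by (simp add: M_def)
        then show ?thesis using \<epsilon> by simp
      qed
      show "\<exists>n\<le>N. \<exists>f. f 0 = p \<and> f n = q \<and> (\<forall>i\<le>n. ball (f i) (\<epsilon> * \<rho>) \<subseteq> F \<and> dist p (f i) \<le> \<epsilon> * R) \<and>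
          (\<forall>i<n. dist (f i) (f (Suc i)) + 2 * (\<epsilon> * \<rho>) \<le> \<epsilon> * r\<^sub>0)"
        if p: "ball p (\<epsilon> * \<rho>) \<subseteq> F" and q: "ball q (\<epsilon> * \<rho>) \<subseteq> F" and pq: "dist p q \<le> \<epsilon> * 1 + 2 * (\<epsilon> * M)" for p q
      proof -
        define p' where "p' = p /\<^sub>R \<epsilon>"
        define q' where "q' = q /\<^sub>R \<epsilon>"
        have pq': "p = \<epsilon> *\<^sub>R p'" "q = \<epsilon> *\<^sub>R q'" using \<epsilon> by (simp_all add: p'_def q'_def)
        have "\<epsilon> * dist p' q' \<le> \<epsilon> * (1 + 2 * M)" using pq unfolding pq' dist_scale by (simp add: algebra_simps)
        then have "dist p' q' < 1 + 2 * M + 1" using \<epsilon> by simp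
        then obtain n f where f: "n \<le> N" "f 0 = p'" "f n = q'"
          "\<forall>i\<le>n. ball (f i) \<rho> \<subseteq> E \<and> dist p' (f i) \<le> R" "\<forall>i<n. dist (f i) (f (Suc i)) \<le> 4 * s"
          using N[rule_format, of p' q'] p q F_ball unfolding p'_def q'_def by blast
        have "\<epsilon> * dist (f i) (f (Suc i)) + 2 * (\<epsilon> * \<rho>) \<le> \<epsilon> * r\<^sub>0" if "i < n" for i
        proof -
          have "dist (f i) (f (Suc i)) + 2 * \<rho> \<le> r\<^sub>0" using f(5) that \<rho>(2) by (force simp: s_def)
          then have "\<epsilon> * (dist (f i) (f (Suc i)) + 2 * \<rho>) \<le> \<epsilon> * r\<^sub>0" using \<epsilon> by simp
          then show ?thesis by (simp add: algebra_simps)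
        qed
        then show ?thesis
          using f \<epsilon> pq' F_ball'
          by (intro exI[of _ n] exI[of _ "\<lambda>i. \<epsilon> *\<^sub>R f i"] conjI) (simp_all add: dist_scale)
      qed
      show "ball x (\<epsilon> * M + \<epsilon> * R + \<epsilon> * \<rho>) \<subseteq> \<Omega>" if "x \<in> A" for x
        using inner_part_ball_subset[of x \<Omega> "k * \<epsilon>"] that by (simp add: A_def k_def algebra_simps)
    qed (use assms(8) \<open>open F\<close> \<epsilon> \<rho> M R u' in auto)
    \<comment> \<open>\<open>v\<close> is built from \<open>u'\<close>, which agrees with
      \<open>u\<close> only almost everywhere; \<open>w\<close> restores equality at every point of
      \<open>\<Omega> \<inter> F\<close> without changing any integral.\<close>
    define w where "w x = (if x \<in> \<Omega> \<inter> F then u x else v x)" for x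
    have w_eq: "AE x in lborel. w x = v x"
      using u_eq by (auto elim!: eventually_mono simp: w_def v_def)
    have w_sq: "(\<integral>\<^sup>+x\<in>B. ennreal ((w x)\<^sup>2) \<partial>lebesgue) = (\<integral>\<^sup>+x\<in>B. ennreal ((v x)\<^sup>2) \<partial>lborel)" for B
      unfolding nn_integral_completion
      using w_eq by (intro nn_integral_cong_AE) (auto elim!: eventually_mono)
    have scale: "\<epsilon> * a / (\<epsilon> * b) = a / b" "(\<epsilon> * a + \<epsilon> * b) / (\<epsilon> * c) = (a + b) / c"
      "(\<epsilon> * a + \<epsilon> * b + \<epsilon> * d) / (\<epsilon> * c) = (a + b + d) / c" for a b c d
      using \<epsilon> by (simp_all add: distrib_left[symmetric])
    have sq: "(\<integral>\<^sup>+x\<in>\<Omega>. ennreal ((w x)\<^sup>2) \<partial>lebesgue) \<le> ennreal C2 * (\<integral>\<^sup>+x\<in>\<Omega> \<inter> F. ennreal ((u x)\<^sup>2) \<partial>lebesgue)"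
      unfolding w_sq u_sq C2_def using square_bound unfolding scale .
    \<comment> \<open>The sum dominates both constants, and \<open>C2 > 0\<close> makes it
      positive.\<close>
    have C_le: "ennreal C1 \<le> ennreal (C1 + C2)" "ennreal C2 \<le> ennreal (C1 + C2)"
      using C by (auto intro: ennreal_leI)
    have "w square_integrable_on \<Omega>"
      unfolding square_integrable_on_def
    proof
      have \<Omega>_leb: "\<Omega> \<in> sets lebesgue" using assms(8) by auto
      have "v \<in> borel_measurable lebesgue" using v_borel by (simp add: measurable_completion)
      then have "(\<lambda>x. if x \<in> \<Omega> \<inter> F then indicator (\<Omega> \<inter> F) x * u x else v x) \<in> borel_measurable lebesgue"
        using S_leb by (intro measurable_If_set u_meas) auto
      moreover have "(\<lambda>x. if x \<in> \<Omega> \<inter> F then indicator (\<Omega> \<inter> F) x * u x else v x) = w"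
        by (auto simp: w_def)
      ultimately have "w \<in> borel_measurable lebesgue" by simp
      then show w_meas: "w \<in> borel_measurable (lebesgue_on \<Omega>)" by (rule measurable_restrict_space1)
      have "(\<integral>\<^sup>+x. ennreal ((w x)\<^sup>2) \<partial>lebesgue_on \<Omega>) = (\<integral>\<^sup>+x\<in>\<Omega>. ennreal ((w x)\<^sup>2) \<partial>lebesgue)"
        using \<Omega>_leb by (simp add: nn_integral_restrict_space)
      also have "\<dots> < \<infinity>" using sq u_int by (auto simp: ennreal_mult_less_top intro: le_less_trans)
      finally show "integrable (lebesgue_on \<Omega>) (\<lambda>x. (w x)\<^sup>2)"
        using w_meas by (intro integrableI_nonneg) auto
    qed
    moreover have "nonlocal_energy A \<epsilon> 1 w \<le> ennreal (C1 + C2) * nonlocal_energy (\<Omega> \<inter> F) \<epsilon> r\<^sub>0 u"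
    proof -
      have "nonlocal_energy A \<epsilon> 1 w = ennreal (1 / \<epsilon>\<^sup>2) * pair_energy A (\<epsilon> * 1) v"
        using w_eq by (intro nonlocal_energy_eq_pair_energy A_borel v_borel \<epsilon>) (auto elim!: eventually_mono)
      also have "\<dots> \<le> ennreal (1 / \<epsilon>\<^sup>2) * (ennreal C1 * pair_energy (\<Omega> \<inter> F) (\<epsilon> * r\<^sub>0) u')"
        using energy_bound unfolding scale C1_def[symmetric] by (rule mult_left_mono) simp
      also have "\<dots> = ennreal C1 * nonlocal_energy (\<Omega> \<inter> F) \<epsilon> r\<^sub>0 u"
        using nonlocal_energy_eq_pair_energy[OF S_borel u' u_eq \<epsilon>, of r\<^sub>0] by (simp add: mult.left_commute)
      also have "\<dots> \<le> ennreal (C1 + C2) * nonlocal_energy (\<Omega> \<inter> F) \<epsilon> r\<^sub>0 u"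
        using C_le(1) by (rule mult_right_mono) simp
      finally show ?thesis .
    qed
    moreover have "(\<integral>\<^sup>+x\<in>A. ennreal ((w x)\<^sup>2) \<partial>lebesgue)
        \<le> ennreal (C1 + C2) * (\<integral>\<^sup>+x\<in>\<Omega> \<inter> F. ennreal ((u x)\<^sup>2) \<partial>lebesgue)"
    proof -
      have "(\<integral>\<^sup>+x\<in>A. ennreal ((w x)\<^sup>2) \<partial>lebesgue) \<le> (\<integral>\<^sup>+x\<in>\<Omega>. ennreal ((w x)\<^sup>2) \<partial>lebesgue)"
        by (intro nn_integral_mono) (auto simp: A_def inner_part_def indicator_def)
      also note sq
      also have "ennreal C2 * (\<integral>\<^sup>+x\<in>\<Omega> \<inter> F. ennreal ((u x)\<^sup>2) \<partial>lebesgue)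
          \<le> ennreal (C1 + C2) * (\<integral>\<^sup>+x\<in>\<Omega> \<inter> F. ennreal ((u x)\<^sup>2) \<partial>lebesgue)"
        using C_le(2) by (rule mult_right_mono) simp
      finally show ?thesis .
    qed
    ultimately show ?thesis
      unfolding F_def[symmetric] A_def[symmetric] by (intro exI[of _ w]) (auto simp: w_def)
  qed
  then show "\<exists>k>0. \<exists>r>0. \<exists>C>0. \<forall>\<epsilon>>0. \<forall>u.
    u square_integrable_on (\<Omega> \<inter> (*\<^sub>R) \<epsilon> ` E) \<longrightarrow>
    (\<exists>v. v square_integrable_on \<Omega> \<and>
       (\<forall>x\<in>\<Omega> \<inter> (*\<^sub>R) \<epsilon> ` E. v x = u x) \<and>
       nonlocal_energy (inner_part \<Omega> (k * \<epsilon>)) \<epsilon> r v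
         \<le> ennreal C * nonlocal_energy (\<Omega> \<inter> (*\<^sub>R) \<epsilon> ` E) \<epsilon> r\<^sub>0 u \<and>
       (\<integral>\<^sup>+x\<in>inner_part \<Omega> (k * \<epsilon>). ennreal ((v x)\<^sup>2) \<partial>lebesgue)
         \<le> ennreal C * (\<integral>\<^sup>+x\<in>\<Omega> \<inter> (*\<^sub>R) \<epsilon> ` E. ennreal ((u x)\<^sup>2) \<partial>lebesgue))"
    using k C by (intro exI[of _ k] exI[of _ "1::real"] exI[of _ "C1 + C2"] conjI) auto
qed

end
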